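(* For every $\lambda\in G$, $\sharp_\lambda\neq\flat_\lambda$.
   Context: $\mathbb{D}$ is the open unit disc in $\mathbb{C}$. $G=\{(z+w,zw): |z|<1,|w|<1\}\subset\mathbb{C}^2$ is the symmetrized bidisc, and $\mathcal{R}=\{(2z,z^2):z\in\mathbb{D}\}$ is the royal variety. Flat direction: the flat geodesics of $G$ are the sets $F^\beta=\{(\beta+\bar\beta z,z):z\in\mathbb{D}\}$, $\beta\in\mathbb{D}$ (equivalently, the complex geodesics $D$ of $G$ such that $D^-\cap\mathcal{R}^-$ is a single point, lying in $\mathcal{R}$). Through each $\lambda\in G$ passes exactly one flat geodesic $F$, and $\flat_\lambda=T_\lambda F$, its complex tangent space at $\lambda$ (for $F=F^\beta$, $\flat_\lambda=\mathbb{C}(\bar\beta,1)$). Sharp direction: let $\mathrm{Orb}(\lambda)$ be the orbit of $\lambda\in G$ under the group $\mathrm{Aut}\,G$ of biholomorphic self-maps of $G$. It is known that $\mathrm{Orb}(\lambda)=\mathcal{R}$ if $\lambda\in\mathcal{R}$, and $\mathrm{Orb}(\lambda)$ is a smooth properly embedded real 3-dimensional submanifold of $G$ if $\lambda\notin\mathcal{R}$. In both cases the real tangent space to $\mathrm{Orb}(\lambda)$ at $\lambda$ contains a unique one-dimensional complex subspace of $\mathbb{C}^2$, denoted $\sharp_\lambda$. *)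

theory Defs
  imports "HOL-Analysis.Analysis"
begin

definition sym_bidisc :: "(complex^2) set" where
  "sym_bidisc = {vector [z + w, z * w] | z w. z \<in> ball 0 1 \<and> w \<in> ball 0 1}"

text \<open>
  Holomorphy in several variables: the Frechet derivative exists and is complex linear.
  All uses below are on the open set \<^term>\<open>sym_bidisc\<close>.
\<close>

definition holomorphic_map_on :: "(complex^'n \<Rightarrow> complex^'m) \<Rightarrow> (complex^'n) set \<Rightarrow> bool" where
  "holomorphic_map_on f S \<longleftrightarrow>
     (\<forall>x\<in>S. \<exists>f'. (f has_derivative f') (at x within S) \<and>
            Vector_Spaces.linear vector_scalar_mult vector_scalar_mult f')"

definition automorphisms :: "(complex^'n) set \<Rightarrow> (complex^'n \<Rightarrow> complex^'n) set" where
  "automorphisms S =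
     {f. bij_betw f S S \<and> holomorphic_map_on f S \<and> holomorphic_map_on (inv_into S f) S}"

definition Orb :: "complex^2 \<Rightarrow> (complex^2) set" where
  "Orb x = {f x | f. f \<in> automorphisms sym_bidisc}"

text \<open>
  The real tangent space, as the set of velocities at \<open>p\<close> of \<open>C\<^sup>1\<close> curves lying in \<open>M\<close>. For an
  embedded submanifold \<open>M\<close> this is the usual tangent space; for a complex submanifold it is
  also, as a set, the complex tangent space.
\<close>

definition tangent_space :: "'a::real_normed_vector set \<Rightarrow> 'a \<Rightarrow> 'a set" where
  "tangent_space M p =
     {v. \<exists>\<gamma> \<epsilon>. \<epsilon> > 0 \<and> \<gamma> C1_differentiable_on {-\<epsilon><..<\<epsilon>} \<and> \<gamma> ` {-\<epsilon><..<\<epsilon>} \<subseteq> M \<and>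
           \<gamma> 0 = p \<and> (\<gamma> has_vector_derivative v) (at 0)}"

definition flat_geodesic :: "complex \<Rightarrow> (complex^2) set" where
  "flat_geodesic \<beta> = {vector [\<beta> + cnj \<beta> * z, z] | z. z \<in> ball 0 1}"

definition flat_direction :: "complex^2 \<Rightarrow> (complex^2) set" where
  "flat_direction x =
     tangent_space (THE F. F \<in> flat_geodesic ` ball 0 1 \<and> x \<in> F) x"

text \<open>
  \<^term>\<open>vec.subspace\<close> and \<^term>\<open>vec.dim\<close> refer to the complex vector space structure
  \<^term>\<open>vector_scalar_mult\<close> of \<^typ>\<open>complex^2\<close>.
\<close>

definition sharp_direction :: "complex^2 \<Rightarrow> (complex^2) set" where
  "sharp_direction x =
     (THE V. vec.subspace V \<and> vec.dim V = 1 \<and> V \<subseteq> tangent_space (Orb x) x)"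

end

theory Submission imports Defs "HOL-Complex_Analysis.Riemann_Mapping" begin

text \<open>
  The proof computes both directions in terms of the flat parameter \<open>\<beta>\<close> of \<open>x = (s, p)\<close>,
  that is, the unique \<open>\<beta>\<close> in the disc with \<open>s = \<beta> + cnj \<beta> p\<close>. The flat direction contains
  \<open>(cnj \<beta>, 1)\<close>. The sharp direction is spanned by \<open>(2 - cnj \<beta> s, s - 2 cnj \<beta> p)\<close>. If they
  agree, then \<open>1 - cnj \<beta> s + (cnj \<beta>)\<^sup>2 p = 0\<close>; for \<open>x = (z + w, z w)\<close> the left-hand side is
  \<open>(1 - cnj \<beta> z) (1 - cnj \<beta> w)\<close>, which is nonzero for \<open>\<beta>\<close>, \<open>z\<close> and \<open>w\<close> in the disc.

  Every Moebius map of the disc acts on \<open>G\<close> by acting on the roots \<open>z\<close> and \<open>w\<close>. The velocities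
  of the resulting curves through \<open>x\<close> include the complex line just mentioned
  (\<open>sharp_line_tangent\<close>). That no other complex line is tangent to the orbit requires an
  upper bound for the orbit, hence for the automorphism group.

  For this bound let \<open>f\<close> be an automorphism. As \<open>z\<close> tends to the unit circle, the discs
  \<open>w \<mapsto> f (z + w, z w)\<close> accumulate at discs in the boundary of \<open>G\<close>, and any two points of
  such a disc have a common root (\<open>boundary_disc_common_root\<close>). The resultant of
  \<open>f (z + w0, z w0)\<close> and \<open>f (z + w1, z w1)\<close> is therefore a holomorphic function of \<open>z\<close> with
  boundary values zero, so it vanishes: images of points with a common root have a
  common root. By a combinatorial argument \<open>f\<close> maps \<open>(z + w, z w)\<close> to \<open>(a z + a w, a z a w)\<close>
  for an automorphism \<open>a\<close> of the disc (\<open>automorphism_of_sym_bidisc\<close>).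

  By the Schwarz-Pick lemma the pseudo-hyperbolic distance of the two roots is constant
  on orbits (\<open>Orb_discr_gap\<close>). Differentiating this invariant confines the tangent vectors
  of the orbit to the real hyperplane on which the real part of some nonzero complex
  linear form vanishes. Such a hyperplane contains only one complex line, the kernel of
  the form (\<open>complex_line_in_real_hyperplane_unique\<close>).
\<close>

section \<open>Points of the symmetrized bidisc as unordered pairs of roots\<close>

text \<open>
  The map from the bidisc onto \<open>G\<close> sends \<open>(z, w)\<close> to the coefficients, up to sign, of the
  polynomial with roots \<open>z\<close> and \<open>w\<close>. Points of \<open>G\<close> are treated throughout as unordered pairs
  of roots.
\<close>

definition sp :: "complex \<Rightarrow> complex \<Rightarrow> complex^2" where
  "sp z w = vector [z + w, z * w]"

definition root_of :: "complex^2 \<Rightarrow> complex \<Rightarrow> bool" where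
  "root_of x t \<longleftrightarrow> t\<^sup>2 - x$1 * t + x$2 = 0"

text \<open>
  This is the resultant of \<open>t\<^sup>2 - x\<^sub>1 t + x\<^sub>2\<close> and \<open>t\<^sup>2 - y\<^sub>1 t + y\<^sub>2\<close>, hence the product of the
  four differences of roots. Being a polynomial in the coordinates, it turns "the two
  points have a common root" into the vanishing of a holomorphic function.
\<close>

definition resultant :: "complex^2 \<Rightarrow> complex^2 \<Rightarrow> complex" where
  "resultant x y = (x$2 - y$2)\<^sup>2 + (x$1 - y$1) * (x$1 * y$2 - y$1 * x$2)"

lemma sp_nth [simp]: "sp z w $ 1 = z + w" "sp z w $ 2 = z * w"
  by (simp_all add: sp_def)

lemma vec2_eq_iff: "x = y \<longleftrightarrow> x$1 = y$1 \<and> x$2 = y$2" for x y :: "'a^2"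
  by (simp add: vec_eq_iff forall_2)

lemma sp_commute: "sp z w = sp w z"
  by (simp add: vec2_eq_iff)

lemma mem_sym_bidisc: "x \<in> sym_bidisc \<longleftrightarrow> (\<exists>z w. norm z < 1 \<and> norm w < 1 \<and> x = sp z w)"
  unfolding sym_bidisc_def sp_def by (auto simp: dist_norm)

lemma root_of_sp [simp]: "root_of (sp z w) t \<longleftrightarrow> t = z \<or> t = w"
proof -
  have "t\<^sup>2 - (z + w) * t + z * w = (t - z) * (t - w)" 
    by (simp add: power2_eq_square algebra_simps)
  thus ?thesis by (simp add: root_of_def)
qed

lemma sp_in_sym_bidisc [simp]: "sp z w \<in> sym_bidisc \<longleftrightarrow> norm z < 1 \<and> norm w < 1"
  by (metis mem_sym_bidisc root_of_sp)

lemma sp_surj: obtains a b where "x = sp a b"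
proof
  let ?d = "csqrt ((x$1)\<^sup>2 - 4 * x$2)"
  have "?d\<^sup>2 = (x$1)\<^sup>2 - 4 * x$2" by simp
  thus "x = sp ((x$1 + ?d) / 2) ((x$1 - ?d) / 2)"
    by (simp add: vec2_eq_iff field_simps power2_eq_square)
qed

lemma root_of_imp_sp: "root_of x z \<Longrightarrow> x = sp z (x$1 - z)"
  by (auto simp: root_of_def vec2_eq_iff power2_eq_square algebra_simps)

lemma sp_eq_iff: "sp z w = sp z' w' \<longleftrightarrow> z = z' \<and> w = w' \<or> z = w' \<and> w = z'"
proof
  assume eq: "sp z w = sp z' w'"
  have "z = z' \<or> z = w'" using root_of_sp [of z w z] eq by auto
  moreover have "z + w = z' + w'" using eq by (metis sp_nth(1))
  ultimately show "z = z' \<and> w = w' \<or> z = w' \<and> w = z'" by auto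
qed (auto simp: sp_commute)

lemma resultant_eq_0_iff: "resultant x y = 0 \<longleftrightarrow> (\<exists>t. root_of x t \<and> root_of y t)"
proof -
  obtain a b where x: "x = sp a b" by (rule sp_surj)
  obtain c d where y: "y = sp c d" by (rule sp_surj)
  have "resultant x y = (a - c) * (a - d) * (b - c) * (b - d)"
    by (simp add: resultant_def x y power2_eq_square algebra_simps)
  thus ?thesis by (auto simp: x y)
qed

lemma norm_mult_less_1:
  fixes c d :: complex
  assumes "norm c < 1" "norm d < 1"
  shows "norm (c * d) < 1"
  using assms mult_strict_mono'[of "norm c" 1 "norm d" 1] by (simp add: norm_mult)

lemma one_minus_mult_nonzero:
  fixes c d :: complex
  assumes "norm c < 1" "norm d < 1"
  shows "1 - c * d \<noteq> 0"
  using norm_mult_less_1[OF assms] by auto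

lemma norm_components_sym_bidisc:
  fixes x :: "complex^2"
  assumes "x \<in> sym_bidisc"
  shows "norm (x$1) < 2" "norm (x$2) < 1"
proof -
  obtain z w where "norm z < 1" "norm w < 1" "x = sp z w" using assms mem_sym_bidisc by blast
  thus "norm (x$1) < 2" "norm (x$2) < 1"
    using norm_triangle_ineq[of z w] norm_mult_less_1[of z w] by auto
qed

text \<open>
  For \<open>s = z + w\<close> and \<open>p = z w\<close> one has \<open>s - p cnj s = z (1 - \<bar>w\<bar>\<^sup>2) + w (1 - \<bar>z\<bar>\<^sup>2)\<close>, and
  \<open>\<bar>z\<bar> (1 - \<bar>w\<bar>\<^sup>2) + \<bar>w\<bar> (1 - \<bar>z\<bar>\<^sup>2)\<close> differs from \<open>1 - \<bar>z w\<bar>\<^sup>2\<close> exactly by the product on the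
  left. In the closed bidisc that product can be dropped, which gives the bound for
  boundary discs; in the open bidisc it is positive, which gives a flat parameter of
  modulus less than one.
\<close>

lemma norm_flat_numerator_le:
  assumes "norm z \<le> 1" "norm w \<le> 1"
  shows "norm ((z + w) - z * w * cnj (z + w)) + (1 - norm z) * (1 - norm w) * (1 - norm z * norm w) \<le> 1 - (norm (z * w))\<^sup>2"
proof -
  have "(z + w) - z * w * cnj (z + w) = z * of_real (1 - (norm w)\<^sup>2) + w * of_real (1 - (norm z)\<^sup>2)"
    by (simp add: complex_norm_square algebra_simps flip: of_real_power)
  also have "norm \<dots> \<le> norm z * (1 - (norm w)\<^sup>2) + norm w * (1 - (norm z)\<^sup>2)"
    using assms
    by (intro order.trans [OF norm_triangle_ineq]) (simp only: norm_mult norm_of_real, simp add: abs_square_le_1)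
  also have "\<dots> = 1 - (norm z * norm w)\<^sup>2 - (1 - norm z) * (1 - norm w) * (1 - norm z * norm w)"
    by (simp add: algebra_simps power2_eq_square)
  finally show ?thesis by (simp add: norm_mult)
qed

section \<open>Analytic discs in the boundary\<close>

lemma holomorphic_bounded_attains_constant:
  assumes "h holomorphic_on ball 0 1" "\<And>w. w \<in> ball 0 1 \<Longrightarrow> norm (h w) \<le> norm (h w0)" 
    "w0 \<in> ball 0 1" "w \<in> ball 0 1"
  shows "h w = h w0"
proof -
  have "h constant_on ball 0 1"
    by (rule maximum_modulus_principle [OF assms(1), of "ball 0 1" w0]) (use assms in auto)
  thus ?thesis using assms unfolding constant_on_def by metis
qed

text \<open>
  The function \<open>exp (i h)\<close> has constant modulus one, so the maximum principle makes it
  constant.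
\<close>

lemma real_valued_holomorphic_constant:
  assumes "h holomorphic_on ball 0 1" "\<And>w. w \<in> ball 0 1 \<Longrightarrow> Im (h w) = 0"
    "w0 \<in> ball 0 1" "w \<in> ball 0 1"
  shows "h w = h w0"
proof -
  define k where "k = (\<lambda>w. exp (\<i> * h w))"
  have "norm (k w) = 1" if "w \<in> ball 0 1" for w
    using assms(2)[OF that] by (simp add: k_def)
  moreover have holk: "k holomorphic_on ball 0 1"
    unfolding k_def by (intro holomorphic_intros assms)
  ultimately have kc: "k w = k w0" if "w \<in> ball 0 1" for w
    using that assms(3) by (intro holomorphic_bounded_attains_constant) auto
  have "(h has_field_derivative 0) (at w)" if w: "w \<in> ball 0 1" for w
  proof -
    obtain h' where h': "(h has_field_derivative h') (at w)"
      using assms(1) w by (metis holomorphic_on_open open_ball)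
    have "(k has_field_derivative exp (\<i> * h w) * (\<i> * h')) (at w)"
      unfolding k_def by (rule derivative_eq_intros h' refl | simp)+
    moreover have "(k has_field_derivative 0) (at w)"
      by (rule has_field_derivative_transform_within_open [where S="ball 0 1" and f="\<lambda>_. k w0"])
        (use w kc in auto)
    ultimately have "exp (\<i> * h w) * (\<i> * h') = 0" by (rule DERIV_unique)
    thus ?thesis using h' by simp
  qed
  hence "\<exists>c. \<forall>x\<in>ball 0 1. h x = c"
    by (intro has_field_derivative_zero_constant) (auto intro: has_field_derivative_at_within)
  thus ?thesis using assms by metis
qed

text \<open>
  A disc whose points all have a unimodular root either is a single point or keeps one
  and the same unimodular root \<open>\<zeta>\<close>; in both cases any two of its points have a common
  root.

  If the product of the roots is unimodular at one point, it is a constant \<open>c\<^sup>2\<close> by the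
  maximum principle. Then all roots are unimodular, the sum of the roots is a real
  multiple of \<open>c\<close>, and it is constant as well.

  Otherwise fix a unimodular root \<open>\<zeta>\<close> at \<open>w0\<close>, put \<open>\<omega> = cnj \<zeta>\<close>, and consider
  \<open>\<Phi>(s, p) = (2 \<omega> p - s) / (2 - \<omega> s)\<close>. This function is bounded by one on the closure of \<open>G\<close>
  where \<open>\<bar>p\<bar> < 1\<close>, and there \<open>\<Phi> = - \<zeta>\<close> holds exactly if \<open>\<zeta>\<close> is a root. Along the disc it
  attains modulus one at \<open>w0\<close>, so it is constantly \<open>- \<zeta>\<close>.
\<close>

lemma boundary_disc_common_root:
  assumes hol: "g1 holomorphic_on ball 0 1" "g2 holomorphic_on ball 0 1"
    and bd: "\<And>w. w \<in> ball 0 1 \<Longrightarrow> \<exists>\<zeta> u. norm \<zeta> = 1 \<and> norm u \<le> 1 \<and> g1 w = \<zeta> + u \<and> g2 w = \<zeta> * u"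
    and w: "w0 \<in> ball 0 1" "w1 \<in> ball 0 1"
  shows "resultant (vector [g1 w0, g2 w0]) (vector [g1 w1, g2 w1]) = 0"
proof (cases "\<exists>v\<in>ball 0 1. norm (g2 v) = 1")
  case True
  then obtain v where v: "v \<in> ball 0 1" "norm (g2 v) = 1" by blast
  have g2_le: "norm (g2 w) \<le> 1" if "w \<in> ball 0 1" for w
    using bd[OF that] by (auto simp: norm_mult)
  have g2: "g2 w = g2 v" if "w \<in> ball 0 1" for w
    using that v g2_le by (intro holomorphic_bounded_attains_constant hol) auto
  define c where "c = csqrt (g2 v)"
  have c2: "c\<^sup>2 = g2 v" by (simp add: c_def)
  have nc: "norm c = 1" using v(2) by (simp add: c_def)
  have cc: "c * cnj c = 1" using nc by (simp flip: complex_norm_square)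
  have "Im (cnj c * g1 w) = 0" if ww: "w \<in> ball 0 1" for w
  proof -
    obtain \<zeta> u where zu: "norm \<zeta> = 1" "g1 w = \<zeta> + u" "g2 w = \<zeta> * u"
      using bd[OF ww] by auto
    have zz: "\<zeta> * cnj \<zeta> = 1" using zu by (simp flip: complex_norm_square)
    have "u = (\<zeta> * cnj \<zeta>) * u" by (simp add: zz)
    also have "\<dots> = cnj \<zeta> * c\<^sup>2" using zu g2[OF ww] by (simp add: c2)
    finally have "cnj c * u = c * cnj \<zeta> * (c * cnj c)"
      by (simp add: power2_eq_square)
    hence "cnj c * g1 w = cnj c * \<zeta> + cnj (cnj c * \<zeta>)"
      by (simp add: zu cc algebra_simps)
    thus ?thesis by simp
  qed
  hence "cnj c * g1 w0 = cnj c * g1 w1"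
    using w by (intro real_valued_holomorphic_constant [where h="\<lambda>w. cnj c * g1 w"] holomorphic_intros hol) auto
  hence "g1 w0 = g1 w1" using nc by auto
  moreover have "g2 w0 = g2 w1" using g2 w by metis
  ultimately show ?thesis by (simp add: resultant_def)
next
  case False
  have lt1: "norm (g2 w) < 1" if "w \<in> ball 0 1" for w
  proof -
    have "norm (g2 w) \<le> 1" using bd[OF that] by (auto simp: norm_mult)
    thus ?thesis using False that by (auto simp: less_le)
  qed
  obtain \<zeta> u where zu: "norm \<zeta> = 1" "norm u \<le> 1" "g1 w0 = \<zeta> + u" "g2 w0 = \<zeta> * u"
    using bd[OF w(1)] by auto
  define \<omega> where "\<omega> = cnj \<zeta>"
  have zo: "\<zeta> * \<omega> = 1" using zu(1) by (simp add: \<omega>_def flip: complex_norm_square)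
  have no: "norm \<omega> = 1" using zu by (simp add: \<omega>_def)
  have nz: "2 - \<omega> * g1 w \<noteq> 0" if ww: "w \<in> ball 0 1" for w
  proof -
    obtain z v where zv: "norm z = 1" "norm v \<le> 1" "g1 w = z + v" "g2 w = z * v"
      using bd[OF ww] by auto
    have "norm v < 1" using lt1[OF ww] zv by (simp add: norm_mult)
    hence "norm (\<omega> * g1 w) < 2" using norm_triangle_ineq[of z v] zv no by (simp add: norm_mult)
    thus ?thesis by auto
  qed
  define \<Phi> where "\<Phi> = (\<lambda>w. (2 * \<omega> * g2 w - g1 w) / (2 - \<omega> * g1 w))"
  have "\<Phi> w0 = - \<zeta>"
  proof -
    have "2 * \<omega> * g2 w0 - g1 w0 = 2 * (\<zeta> * \<omega>) * u - \<zeta> - u" by (simp add: zu algebra_simps)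
    also have "\<dots> = - \<zeta> * (1 - \<omega> * u) + u * (1 - \<zeta> * \<omega>)"
    proof -
      have "- \<zeta> * (1 - \<omega> * u) = - \<zeta> + (\<zeta> * \<omega>) * u" by (simp add: algebra_simps)
      thus ?thesis by (simp add: zo)
    qed
    also have "\<dots> = - \<zeta> * (2 - \<zeta> * \<omega> - \<omega> * u)" by (simp add: zo)
    also have "\<dots> = - \<zeta> * (2 - \<omega> * g1 w0)" by (simp add: zu algebra_simps)
    finally show ?thesis using nz[OF w(1)] by (simp add: \<Phi>_def field_simps)
  qed
  moreover have "norm (\<Phi> w) \<le> 1" if ww: "w \<in> ball 0 1" for w
  proof -
    let ?s = "g1 w" and ?p = "g2 w"
    have "norm (?s - ?p * cnj ?s) \<le> 1 - (norm ?p)\<^sup>2"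
    proof -
      obtain z v where zv: "norm z = 1" "norm v \<le> 1" "?s = z + v" "?p = z * v"
        using bd[OF ww] by auto
      thus ?thesis using norm_flat_numerator_le[of z v] by simp
    qed
    hence "Re (\<omega> * (?s - ?p * cnj ?s)) \<le> 1 - (norm ?p)\<^sup>2"
      using complex_Re_le_cmod[of "\<omega> * (?s - ?p * cnj ?s)"] no by (simp add: norm_mult)
    moreover have "(norm (2 - \<omega> * ?s))\<^sup>2 - (norm (2 * \<omega> * ?p - ?s))\<^sup>2 
        = 4 * (1 - (norm ?p)\<^sup>2 - Re (\<omega> * (?s - ?p * cnj ?s)))"
    proof -
      have oo: "\<omega> * cnj \<omega> = 1" using no by (simp flip: complex_norm_square)
      have "complex_of_real ((norm (2 - \<omega> * ?s))\<^sup>2 - (norm (2 * \<omega> * ?p - ?s))\<^sup>2)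
        = (2 - \<omega> * ?s) * cnj (2 - \<omega> * ?s) - (2 * \<omega> * ?p - ?s) * cnj (2 * \<omega> * ?p - ?s)"
        by (simp only: of_real_diff complex_norm_square)
      also have "\<dots> = 4 + (\<omega> * cnj \<omega>) * ?s * cnj ?s - 4 * (\<omega> * cnj \<omega>) * ?p * cnj ?p - ?s * cnj ?s
           - 2 * (\<omega> * (?s - ?p * cnj ?s)) - 2 * cnj (\<omega> * (?s - ?p * cnj ?s))"
        by (simp add: algebra_simps)
      also have "\<dots> = 4 - 4 * (?p * cnj ?p) 
           - 2 * (\<omega> * (?s - ?p * cnj ?s) + cnj (\<omega> * (?s - ?p * cnj ?s)))"
        unfolding oo by (simp add: algebra_simps)
      also have "\<dots> = of_real (4 * (1 - (norm ?p)\<^sup>2 - Re (\<omega> * (?s - ?p * cnj ?s))))"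
        by (simp only: complex_add_cnj flip: complex_norm_square) (simp add: algebra_simps)
      finally show ?thesis by (simp only: of_real_eq_iff)
    qed
    moreover have "x \<le> y" if "R \<le> 1 - n" "y - x = 4 * (1 - n - R)" for x y n R :: real
      using that by (simp add: algebra_simps)
    ultimately have "(norm (2 * \<omega> * ?p - ?s))\<^sup>2 \<le> (norm (2 - \<omega> * ?s))\<^sup>2" by blast
    hence "norm (2 * \<omega> * ?p - ?s) \<le> norm (2 - \<omega> * ?s)" by (rule power2_le_imp_le) simp
    thus ?thesis using nz[OF ww] by (simp add: \<Phi>_def norm_divide)
  qed
  moreover have "\<Phi> holomorphic_on ball 0 1"
    unfolding \<Phi>_def by (intro holomorphic_intros hol nz)
  ultimately have Phi: "\<Phi> w = - \<zeta>" if "w \<in> ball 0 1" for w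
    using holomorphic_bounded_attains_constant[of \<Phi> w0 w] that w zu(1) by simp
  have "root_of (vector [g1 w, g2 w]) \<zeta>" if ww: "w \<in> ball 0 1" for w
  proof -
    have "2 * \<omega> * g2 w - g1 w = - \<zeta> * (2 - \<omega> * g1 w)" 
      using Phi[OF ww] nz[OF ww] by (simp add: \<Phi>_def field_simps)
    hence "\<zeta> * (2 * \<omega> * g2 w - g1 w) = \<zeta> * (- \<zeta> * (2 - \<omega> * g1 w))" by simp
    hence "2 * (\<zeta> * \<omega>) * g2 w - \<zeta> * g1 w = - 2 * \<zeta>\<^sup>2 + (\<zeta> * \<omega>) * \<zeta> * g1 w"
      by (simp add: power2_eq_square algebra_simps)
    hence "2 * (\<zeta>\<^sup>2 - g1 w * \<zeta> + g2 w) = 0" unfolding zo by (simp add: algebra_simps)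
    hence "\<zeta>\<^sup>2 - g1 w * \<zeta> + g2 w = 0" unfolding mult_eq_0_iff by simp
    thus ?thesis by (simp add: root_of_def)
  qed
  thus ?thesis unfolding resultant_eq_0_iff using w by blast
qed

section \<open>Restricting holomorphic maps to discs\<close>

lemma bounded_linear_vector2: 
  "bounded_linear (\<lambda>x. vector [x, 0] :: complex^2)" "bounded_linear (\<lambda>x. vector [0, x] :: complex^2)"
  by (auto intro!: linearI simp: vec2_eq_iff simp flip: linear_conv_bounded_linear)

lemma vector2_split: "vector [a, b] = vector [a, 0] + (vector [0, b] :: complex^2)"
  by (simp add: vec2_eq_iff)

lemma has_derivative_vector2:
  assumes "(f has_derivative f') F" "(g has_derivative g') F"
  shows "((\<lambda>x. vector [f x, g x] :: complex^2) has_derivative (\<lambda>h. vector [f' h, g' h])) F"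
proof -
  have "((\<lambda>x. vector [f x, 0] + vector [0, g x] :: complex^2) has_derivative 
         (\<lambda>h. vector [f' h, 0] + vector [0, g' h])) F"
    by (intro has_derivative_add bounded_linear.has_derivative [OF bounded_linear_vector2(1)]
        bounded_linear.has_derivative [OF bounded_linear_vector2(2)] assms)
  thus ?thesis by (simp only: vector2_split [symmetric])
qed

lemma tendsto_vector2:
  assumes "(f \<longlongrightarrow> a) F" "(g \<longlongrightarrow> b) F"
  shows "((\<lambda>x. vector [f x, g x] :: complex^2) \<longlongrightarrow> vector [a, b]) F"
proof -
  have "((\<lambda>x. vector [f x, 0] + vector [0, g x] :: complex^2) \<longlongrightarrow> vector [a, 0] + vector [0, b]) F"
    by (intro tendsto_add bounded_linear.tendsto [OF bounded_linear_vector2(1)]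
        bounded_linear.tendsto [OF bounded_linear_vector2(2)] assms)
  thus ?thesis by (simp only: vector2_split [symmetric])
qed

lemma tendsto_sp:
  assumes "(f \<longlongrightarrow> a) F" "(g \<longlongrightarrow> b) F"
  shows "((\<lambda>x. sp (f x) (g x)) \<longlongrightarrow> sp a b) F"
  unfolding sp_def by (intro tendsto_vector2 tendsto_intros assms)

lemma tendsto_resultant:
  assumes "(f \<longlongrightarrow> a) F" "(g \<longlongrightarrow> b) F"
  shows "((\<lambda>x. resultant (f x) (g x)) \<longlongrightarrow> resultant a b) F"
  unfolding resultant_def by (intro tendsto_intros assms)

lemma holomorphic_map_comp_disc:
  fixes f :: "complex^2 \<Rightarrow> complex^2"
  assumes f: "holomorphic_map_on f S" and T: "open T"
    and hol: "\<phi> holomorphic_on T" "\<psi> holomorphic_on T"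
    and mem: "\<And>z. z \<in> T \<Longrightarrow> vector [\<phi> z, \<psi> z] \<in> S"
  shows "(\<lambda>z. f (vector [\<phi> z, \<psi> z]) $ i) holomorphic_on T"
  unfolding holomorphic_on_def
proof
  fix z assume z: "z \<in> T"
  define c where "c = (\<lambda>z. vector [\<phi> z, \<psi> z] :: complex^2)"
  obtain a b where ab: "(\<phi> has_field_derivative a) (at z)" "(\<psi> has_field_derivative b) (at z)"
    using hol T z by (metis holomorphic_on_open)
  have c: "(c has_derivative (\<lambda>h. vector [a * h, b * h])) (at z within T)"
    unfolding c_def using ab[THEN has_field_derivative_at_within, of T]
    by (intro has_derivative_vector2) (simp_all add: has_field_derivative_def)
  obtain f' where f': "(f has_derivative f') (at (c z) within S)"
      and lin: "Vector_Spaces.linear vector_scalar_mult vector_scalar_mult f'"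
    using f mem[OF z] unfolding holomorphic_map_on_def c_def by blast
  have "c ` T \<subseteq> S" using mem by (auto simp: c_def)
  from has_derivative_in_compose [OF c has_derivative_subset [OF f' this]]
  have "((\<lambda>z. f (c z)) has_derivative (\<lambda>h. f' (vector [a * h, b * h]))) (at z within T)" .
  hence "((\<lambda>z. f (c z) $ i) has_derivative (\<lambda>h. f' (vector [a * h, b * h]) $ i)) (at z within T)"
    by (rule bounded_linear.has_derivative [OF bounded_linear_vec_nth])
  moreover have "f' (vector [a * h, b * h]) $ i = f' (vector [a, b]) $ i * h" for h
  proof -
    have "vector [a * h, b * h] = h *s (vector [a, b] :: complex^2)" by (simp add: vec2_eq_iff)
    thus ?thesis using vec.linear_scale[OF lin] by simp
  qed
  ultimately have "((\<lambda>z. f (c z) $ i) has_field_derivative f' (vector [a, b]) $ i) (at z within T)"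
    by (simp add: has_field_derivative_def)
  thus "(\<lambda>z. f (vector [\<phi> z, \<psi> z]) $ i) field_differentiable at z within T"
    unfolding c_def field_differentiable_def by blast
qed

lemma compact_sp: "compact {sp a b | a b. norm a \<le> 1 \<and> norm b \<le> 1}"
proof -
  have "{sp a b | a b. norm a \<le> 1 \<and> norm b \<le> 1} = (\<lambda>(a, b). sp a b) ` (cball 0 1 \<times> cball 0 1)"
    by auto blast
  moreover have "continuous_on (cball 0 1 \<times> cball 0 1) (\<lambda>(a, b). sp a b)"
    unfolding continuous_on_def case_prod_beta by (intro ballI tendsto_sp tendsto_intros)
  ultimately show ?thesis by (simp add: compact_continuous_image compact_Times)
qed

lemma bounded_holomorphic_convergent_subseq:
  fixes F :: "nat \<Rightarrow> complex \<Rightarrow> complex"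
  assumes "\<And>n. F n holomorphic_on ball 0 1" "\<And>n w. w \<in> ball 0 1 \<Longrightarrow> norm (F n w) \<le> B"
  obtains g r where "g holomorphic_on ball 0 1" "strict_mono r"
    "\<And>w. w \<in> ball 0 1 \<Longrightarrow> (\<lambda>n. F (r n) w) \<longlonglongrightarrow> g w"
proof (rule Montel [of "ball 0 1" "range F" F])
  show "\<exists>B. \<forall>h\<in>range F. \<forall>z\<in>K. norm (h z) \<le> B" if "K \<subseteq> ball 0 1" for K
    using assms(2) that by blast
  show "h holomorphic_on ball 0 1" if "h \<in> range F" for h
    using assms(1) that by auto
qed (simp, rule order_refl, rule that)

lemma automorphismsD:
  assumes "f \<in> automorphisms S"
  shows "bij_betw f S S" "holomorphic_map_on f S" "holomorphic_map_on (inv_into S f) S"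
  using assms by (auto simp: automorphisms_def)

lemma holomorphic_map_on_cong:
  assumes "\<And>x. x \<in> S \<Longrightarrow> f x = g x" "holomorphic_map_on f S"
  shows "holomorphic_map_on g S"
  unfolding holomorphic_map_on_def
proof
  fix x assume x: "x \<in> S"
  obtain f' where f': "(f has_derivative f') (at x within S)"
    "Vector_Spaces.linear (*s) (*s) f'" using assms(2) x unfolding holomorphic_map_on_def by blast
  have "(g has_derivative f') (at x within S)"
    by (rule has_derivative_transform [OF x _ f'(1)]) (simp add: assms(1))
  with f' show "\<exists>f'. (g has_derivative f') (at x within S) \<and> Vector_Spaces.linear (*s) (*s) f'" 
    by blast
qed

lemma inverse_automorphism:
  assumes "f \<in> automorphisms S"
  shows "inv_into S f \<in> automorphisms S"
proof -
  note f = automorphismsD[OF assms]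
  have "holomorphic_map_on (inv_into S (inv_into S f)) S"
    by (rule holomorphic_map_on_cong [OF _ f(2)]) (use f(1) in \<open>simp add: inv_into_inv_into_eq\<close>)
  thus ?thesis using f by (simp add: automorphisms_def bij_betw_inv_into)
qed

lemma holomorphic_map_tendsto:
  assumes "holomorphic_map_on f S" "x \<in> S" "\<And>n. X n \<in> S" "X \<longlonglongrightarrow> x"
  shows "(\<lambda>n. f (X n)) \<longlonglongrightarrow> f x"
proof -
  have "continuous (at x within S) f"
    using assms(1,2) unfolding holomorphic_map_on_def by (blast intro: has_derivative_continuous)
  thus ?thesis using assms(3,4) unfolding continuous_within_sequentially by (auto simp: o_def)
qed

section \<open>Automorphisms come from automorphisms of the disc\<close>

text \<open>
  By Montel's theorem the discs \<open>w \<mapsto> f (sp (Z n) w)\<close> converge along a subsequence. Since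
  \<open>sp (Z n) w\<close> leaves every compact subset of \<open>G\<close> and the inverse of \<open>f\<close> is continuous, the
  limit disc lies in the boundary of \<open>G\<close>, where any two points of a disc have a common
  root.
\<close>

lemma automorphism_resultant_subseq:
  assumes f: "f \<in> automorphisms sym_bidisc" and w: "w0 \<in> ball 0 1" "w1 \<in> ball 0 1"
    and Z: "\<And>n. Z n \<in> ball 0 1" "Z \<longlonglongrightarrow> \<zeta>" "norm \<zeta> = 1"
  obtains r where "strict_mono r" 
    "(\<lambda>n. resultant (f (sp (Z (r n)) w0)) (f (sp (Z (r n)) w1))) \<longlonglongrightarrow> 0"
proof -
  note fD = automorphismsD[OF f]
  define F where "F i n w = f (sp (Z n) w) $ i" for i n w
  have fG: "f x \<in> sym_bidisc" if "x \<in> sym_bidisc" for x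
    using fD(1) that by (auto simp: bij_betw_def)
  have spG: "sp (Z n) w \<in> sym_bidisc" if "w \<in> ball 0 1" for n w
    using Z(1)[of n] that by simp
  have hol: "F i n holomorphic_on ball 0 1" for i n
    unfolding F_def sp_def 
    by (rule holomorphic_map_comp_disc [OF fD(2)]) 
      (use spG in \<open>auto intro!: holomorphic_intros simp flip: sp_def\<close>)
  obtain g1 r1 where g1: "g1 holomorphic_on ball 0 1" "strict_mono r1"
    "\<And>w. w \<in> ball 0 1 \<Longrightarrow> (\<lambda>n. F 1 (r1 n) w) \<longlonglongrightarrow> g1 w"
    by (rule bounded_holomorphic_convergent_subseq [of "F 1" 2])
      (use hol norm_components_sym_bidisc[OF fG[OF spG]] in \<open>auto simp: F_def less_imp_le\<close>)
  obtain g2 r2 where g2: "g2 holomorphic_on ball 0 1" "strict_mono r2"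
    "\<And>w. w \<in> ball 0 1 \<Longrightarrow> (\<lambda>n. F 2 (r1 (r2 n)) w) \<longlonglongrightarrow> g2 w"
    by (rule bounded_holomorphic_convergent_subseq [of "\<lambda>n. F 2 (r1 n)" 1])
      (use hol norm_components_sym_bidisc[OF fG[OF spG]] in \<open>auto simp: F_def less_imp_le\<close>)
  define r where "r = r1 \<circ> r2"
  have r: "strict_mono r" unfolding r_def using g1(2) g2(2) by (rule strict_mono_o)
  define g where "g w = (vector [g1 w, g2 w] :: complex^2)" for w
  have lim: "(\<lambda>n. f (sp (Z (r n)) w)) \<longlonglongrightarrow> g w" if ww: "w \<in> ball 0 1" for w
  proof -
    have "(\<lambda>n. F 1 (r n) w) \<longlonglongrightarrow> g1 w"
      using LIMSEQ_subseq_LIMSEQ [OF g1(3)[OF ww] g2(2)] by (simp add: r_def o_def)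
    moreover have "(\<lambda>n. F 2 (r n) w) \<longlonglongrightarrow> g2 w" using g2(3)[OF ww] by (simp add: r_def)
    ultimately have "(\<lambda>n. vector [F 1 (r n) w, F 2 (r n) w] :: complex^2) \<longlonglongrightarrow> g w"
      unfolding g_def by (rule tendsto_vector2)
    moreover have "vector [F 1 n w, F 2 n w] = f (sp (Z n) w)" for n
      by (simp add: vec2_eq_iff F_def)
    ultimately show ?thesis by simp
  qed
  have bd: "\<exists>z u. norm z = 1 \<and> norm u \<le> 1 \<and> g1 w = z + u \<and> g2 w = z * u" if ww: "w \<in> ball 0 1" for w
  proof -
    have "g w \<in> {sp a b | a b. norm a \<le> 1 \<and> norm b \<le> 1}"
    proof (rule Lim_in_closed_set [OF compact_imp_closed[OF compact_sp] _ _ lim[OF ww]])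
      have "f (sp (Z n) w) \<in> {sp a b | a b. norm a \<le> 1 \<and> norm b \<le> 1}" for n
        using fG[OF spG[OF ww]] unfolding mem_sym_bidisc by (metis (mono_tags, lifting) less_imp_le mem_Collect_eq)
      thus "\<forall>\<^sub>F n in sequentially. f (sp (Z (r n)) w) \<in> {sp a b | a b. norm a \<le> 1 \<and> norm b \<le> 1}" by simp
    qed auto
    then obtain a b where ab: "norm a \<le> 1" "norm b \<le> 1" "g w = sp a b" by blast
    have "g w \<notin> sym_bidisc"
    proof
      assume gw: "g w \<in> sym_bidisc"
      let ?h = "inv_into sym_bidisc f"
      have "(\<lambda>n. ?h (f (sp (Z (r n)) w))) \<longlonglongrightarrow> ?h (g w)"
        by (rule holomorphic_map_tendsto [OF fD(3) gw _ lim[OF ww]]) (use fG spG ww in blast)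
      moreover have "?h (f (sp (Z (r n)) w)) = sp (Z (r n)) w" for n
        using fD(1) spG[OF ww] by (auto simp: bij_betw_def)
      moreover have "(\<lambda>n. sp (Z (r n)) w) \<longlonglongrightarrow> sp \<zeta> w"
        using LIMSEQ_subseq_LIMSEQ [OF Z(2) r] by (intro tendsto_sp) (auto simp: o_def)
      ultimately have "sp \<zeta> w = ?h (g w)" using LIMSEQ_unique by (simp)
      moreover have "?h (g w) \<in> sym_bidisc"
        using gw fD(1) by (metis bij_betw_def inv_into_into)
      ultimately show False using Z(3) by (metis less_irrefl sp_in_sym_bidisc)
    qed
    hence "norm a = 1 \<or> norm b = 1" using ab by auto
    moreover have "g1 w = a + b" "g2 w = a * b" using ab(3) by (simp_all add: g_def vec2_eq_iff)
    ultimately show ?thesis using ab by (metis add.commute mult.commute)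
  qed
  have "(\<lambda>n. resultant (f (sp (Z (r n)) w0)) (f (sp (Z (r n)) w1))) \<longlonglongrightarrow> resultant (g w0) (g w1)"
    by (intro tendsto_resultant lim w)
  also have "resultant (g w0) (g w1) = 0"
    unfolding g_def by (rule boundary_disc_common_root [OF g1(1) g2(1) bd w])
  finally show ?thesis using that r by blast
qed

lemma limseq_subsubseq:
  fixes X :: "nat \<Rightarrow> 'a::metric_space"
  assumes "\<And>r :: nat \<Rightarrow> nat. strict_mono r \<Longrightarrow> \<exists>q :: nat \<Rightarrow> nat. strict_mono q \<and> (\<lambda>n. X (r (q n))) \<longlonglongrightarrow> l"
  shows "X \<longlonglongrightarrow> l"
proof (rule ccontr)
  assume "\<not> X \<longlonglongrightarrow> l"
  then obtain e where e: "e > 0" "\<exists>\<^sub>F n in sequentially. \<not> dist (X n) l < e"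
    unfolding tendsto_iff frequently_def by auto
  hence "infinite {n. \<not> dist (X n) l < e}"
    by (simp add: frequently_cofinite flip: cofinite_eq_sequentially)
  then obtain r :: "nat \<Rightarrow> nat" where r: "strict_mono r" "\<And>n. r n \<in> {n. \<not> dist (X n) l < e}"
    using infinite_enumerate by blast
  obtain q where q: "(\<lambda>n. X (r (q n))) \<longlonglongrightarrow> l" using assms[OF r(1)] by blast
  then obtain n where "dist (X (r (q n))) l < e"
    using e(1) unfolding tendsto_iff eventually_sequentially by blast
  with r(2)[of "q n"] show False by simp
qed

lemma holomorphic_vanishing_at_boundary:
  assumes hol: "h holomorphic_on ball 0 1"
    and lim: "\<And>Z \<zeta>. \<lbrakk>\<And>n. Z n \<in> ball 0 1; Z \<longlonglongrightarrow> \<zeta>; norm \<zeta> = 1\<rbrakk> \<Longrightarrow> (\<lambda>n. h (Z n)) \<longlonglongrightarrow> 0"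
    and z: "z \<in> ball 0 (1::real)"
  shows "h z = (0::complex)"
proof -
  \<comment> \<open>the extension by zero is continuous on the closed disc\<close>
  define k where "k = (\<lambda>z. if norm z < 1 then h z else 0)"
  have "continuous (at \<zeta> within cball 0 1) k" if "\<zeta> \<in> cball 0 1" for \<zeta>
  proof (cases "norm \<zeta> < 1")
    case True
    have "isCont h \<zeta>" using holomorphic_on_imp_continuous_on [OF hol] True
      by (simp add: continuous_on_eq_continuous_at)
    moreover have "\<forall>\<^sub>F x in nhds \<zeta>. h x = k x"
      using eventually_nhds_in_open[of "ball 0 1" \<zeta>] True
      by (auto elim!: eventually_mono simp: k_def)
    ultimately have "isCont k \<zeta>" by (simp add: isCont_cong)
    thus ?thesis by (rule continuous_at_imp_continuous_within)
  next
    case False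
    hence z1: "norm \<zeta> = 1" using that by auto
    have "(h \<longlongrightarrow> 0) (at \<zeta> within ball 0 1)"
      unfolding tendsto_at_iff_sequentially using lim z1 by (auto simp: o_def)
    hence *: "\<forall>e>0. \<forall>\<^sub>F x in at \<zeta> within ball 0 1. norm (h x) < e" 
      unfolding tendsto_iff by simp
    have "(k \<longlongrightarrow> 0) (at \<zeta> within cball 0 1)"
      unfolding tendsto_iff
    proof (intro allI impI)
      fix e :: real assume e: "e > 0"
      with * have "\<forall>\<^sub>F x in at \<zeta> within ball 0 1. norm (h x) < e" by blast
      hence "\<forall>\<^sub>F x in nhds \<zeta>. x \<noteq> \<zeta> \<longrightarrow> x \<in> ball 0 1 \<longrightarrow> norm (h x) < e" 
        by (simp add: eventually_at_filter)
      hence "\<forall>\<^sub>F x in nhds \<zeta>. x \<noteq> \<zeta> \<longrightarrow> x \<in> cball 0 1 \<longrightarrow> dist (k x) 0 < e"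
        by (rule eventually_mono) (use e in \<open>auto simp: k_def\<close>)
      thus "\<forall>\<^sub>F x in at \<zeta> within cball 0 1. dist (k x) 0 < e" by (simp add: eventually_at_filter)
    qed
    thus ?thesis using z1 by (simp add: continuous_within k_def)
  qed
  hence "continuous_on (cball 0 1) k" by (simp add: continuous_on_eq_continuous_within)
  moreover have "k holomorphic_on ball 0 1"
    by (rule holomorphic_transform [OF hol]) (simp add: k_def)
  ultimately have "norm (k z) \<le> 0"
    by (intro maximum_modulus_frontier [of k "ball 0 1" 0 z] z) (simp_all add: k_def)
  thus ?thesis using z by (simp add: k_def)
qed

text \<open>
  For fixed \<open>w0\<close> and \<open>w1\<close> the resultant is holomorphic in \<open>z\<close> and tends to zero at the unit
  circle, hence vanishes identically. Working with the resultant of two points, rather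
  than with derivatives of \<open>f\<close>, keeps the argument in one complex variable.
\<close>

lemma automorphism_common_root:
  assumes f: "f \<in> automorphisms sym_bidisc" and w: "w0 \<in> ball 0 1" "w1 \<in> ball 0 1" 
    and z: "z \<in> ball 0 1"
  shows "\<exists>t. root_of (f (sp z w0)) t \<and> root_of (f (sp z w1)) t"
proof -
  note fD = automorphismsD[OF f]
  define h where "h z = resultant (f (sp z w0)) (f (sp z w1))" for z
  have "h z = 0"
  proof (rule holomorphic_vanishing_at_boundary [OF _ _ z])
    have *: "(\<lambda>z. f (sp z w) $ i) holomorphic_on ball 0 1" if "w \<in> ball 0 1" for w i
      unfolding sp_def
      by (rule holomorphic_map_comp_disc [OF fD(2)]) 
        (use that in \<open>auto intro!: holomorphic_intros simp flip: sp_def\<close>)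
    show "h holomorphic_on ball 0 1"
      unfolding h_def resultant_def by (intro holomorphic_intros * w)
  next
    fix Z :: "nat \<Rightarrow> complex" and \<zeta> assume Z: "\<And>n. Z n \<in> ball 0 (1::real)" "Z \<longlonglongrightarrow> \<zeta>" "norm \<zeta> = 1"
    show "(\<lambda>n. h (Z n)) \<longlonglongrightarrow> 0"
    proof (rule limseq_subsubseq)
      fix r :: "nat \<Rightarrow> nat" assume r: "strict_mono r"
      have "(\<lambda>n. Z (r n)) \<longlonglongrightarrow> \<zeta>" using LIMSEQ_subseq_LIMSEQ [OF Z(2) r] by (simp add: o_def)
      then obtain q where "strict_mono q" "(\<lambda>n. h (Z (r (q n)))) \<longlonglongrightarrow> 0"
        unfolding h_def by (rule automorphism_resultant_subseq [OF f w Z(1) _ Z(3)])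
      thus "\<exists>q :: nat \<Rightarrow> nat. strict_mono q \<and> (\<lambda>n. h (Z (r (q n)))) \<longlonglongrightarrow> 0" by blast
    qed
  qed
  thus ?thesis unfolding h_def resultant_eq_0_iff .
qed

lemma sp_same_root: "sp z w = sp z w' \<longleftrightarrow> w = w'"
  by (auto simp: sp_eq_iff)

text \<open>
  Sets with at most two elements that meet pairwise either have an element in common or
  are the three edges of a triangle, and an infinite family is not the latter.
\<close>

lemma pairwise_common_root_imp_common_root:
  assumes inf: "infinite X" and pair: "\<And>x y. x \<in> X \<Longrightarrow> y \<in> X \<Longrightarrow> \<exists>t. root_of x t \<and> root_of y t"
  shows "\<exists>t. \<forall>x\<in>X. root_of x t"
proof (rule ccontr)
  assume no: "\<nexists>t. \<forall>x\<in>X. root_of x t"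
  obtain x where x: "x \<in> X" using inf by (metis finite.emptyI ex_in_conv)
  obtain a b where xab: "x = sp a b" by (rule sp_surj)
  obtain y where y: "y \<in> X" "\<not> root_of y a" using no by blast
  have yb: "root_of y b" using pair[OF x y(1)] y(2) by (auto simp: xab)
  then obtain c where ybc: "y = sp b c" using root_of_imp_sp by blast
  obtain z where z: "z \<in> X" "\<not> root_of z b" using no by blast
  have za: "root_of z a" using pair[OF x z(1)] z(2) by (auto simp: xab)
  have zc: "root_of z c" using pair[OF y(1) z(1)] z(2) by (auto simp: ybc)
  have ne: "a \<noteq> b" "a \<noteq> c" using y(2) by (auto simp: ybc)
  obtain d where "z = sp a d" using root_of_imp_sp za by blast
  hence zac: "z = sp a c" using zc ne by auto
  have bc: "b \<noteq> c" using z(2) zc by blast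
  have "v \<in> {x, y, z}" if v: "v \<in> X" for v
  proof -
    have vx: "root_of v a \<or> root_of v b" using pair[OF x v] by (auto simp: xab)
    have vy: "root_of v b \<or> root_of v c" using pair[OF y(1) v] by (auto simp: ybc)
    have vz: "root_of v a \<or> root_of v c" using pair[OF z(1) v] by (auto simp: zac)
    have two: "v = sp p q" if "root_of v p" "root_of v q" "p \<noteq> q" for p q
    proof -
      obtain e where "v = sp p e" using root_of_imp_sp \<open>root_of v p\<close> by blast
      thus ?thesis using that by auto
    qed
    show ?thesis using vx vy vz two[of a b] two[of b c] two[of a c] ne bc
      by (auto simp: xab ybc zac)
  qed
  hence "X \<subseteq> {x, y, z}" by blast
  thus False using inf finite_subset by blast
qed

text \<open>
  The image of the line of points with root \<open>z\<close> consists of points with pairwise common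
  roots, and it is infinite because \<open>f\<close> is injective.
\<close>

lemma automorphism_line:
  assumes f: "f \<in> automorphisms sym_bidisc" and z: "z \<in> ball 0 1"
  shows "\<exists>t\<in>ball 0 1. \<forall>w\<in>ball 0 1. root_of (f (sp z w)) t"
proof -
  note fD = automorphismsD[OF f]
  let ?X = "(\<lambda>w. f (sp z w)) ` ball 0 1"
  have "inj_on (\<lambda>w. f (sp z w)) (ball 0 1)"
  proof (rule inj_onI)
    fix w w' assume w: "w \<in> ball 0 1" "w' \<in> ball 0 1" "f (sp z w) = f (sp z w')"
    have "sp z w = sp z w'"
      by (rule inj_onD [OF bij_betw_imp_inj_on [OF fD(1)] w(3)]) (use z w in auto)
    thus "w = w'" by (simp add: sp_same_root)
  qed
  moreover have "infinite (ball (0::complex) 1)"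
    by (metis countable_finite uncountable_ball zero_less_one)
  ultimately have "infinite ?X" using finite_imageD by blast
  hence "\<exists>t. \<forall>x\<in>?X. root_of x t"
    by (rule pairwise_common_root_imp_common_root) (use automorphism_common_root f z in blast)
  then obtain t where t: "\<And>w. w \<in> ball 0 1 \<Longrightarrow> root_of (f (sp z w)) t" by blast
  have "f (sp z 0) \<in> sym_bidisc" using fD(1) z by (auto simp: bij_betw_def)
  then obtain c d where "norm c < 1" "norm d < 1" "f (sp z 0) = sp c d" 
    unfolding mem_sym_bidisc by blast
  hence "t \<in> ball 0 1" using t[of 0] by auto
  thus ?thesis using t by blast
qed

lemma automorphism_lines_inverse:
  assumes f: "f \<in> automorphisms sym_bidisc"
    and a: "\<And>z w. z \<in> ball 0 1 \<Longrightarrow> w \<in> ball 0 1 \<Longrightarrow> root_of (f (sp z w)) (a z)"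
    and b: "\<And>z w. z \<in> ball 0 1 \<Longrightarrow> w \<in> ball 0 1 \<Longrightarrow> root_of (inv_into sym_bidisc f (sp z w)) (b z)"
    and aB: "\<And>z. z \<in> ball 0 1 \<Longrightarrow> a z \<in> ball 0 1" and z: "z \<in> ball 0 1"
  shows "b (a z) = z"
proof -
  note fD = automorphismsD[OF f]
  have "root_of (sp z w) (b (a z))" if w: "w \<in> ball 0 1" for w
  proof -
    have G: "sp z w \<in> sym_bidisc" using z w by auto
    hence "f (sp z w) \<in> sym_bidisc" using fD(1) by (auto simp: bij_betw_def)
    moreover obtain u where u: "f (sp z w) = sp (a z) u" using a[OF z w] root_of_imp_sp by blast
    ultimately have uB: "u \<in> ball 0 1" by auto
    have "sp z w = inv_into sym_bidisc f (sp (a z) u)" 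
      using fD(1) G by (simp add: bij_betw_def flip: u)
    thus ?thesis using b[OF aB[OF z] uB] by simp
  qed
  from this[of 0] this[of "1/2"] show ?thesis by auto
qed

text \<open>
  The line of points with root \<open>z\<close> goes into the line of points with root \<open>a z\<close>. Applying
  this to the inverse of \<open>f\<close> shows that \<open>a\<close> is bijective. The point \<open>sp z w\<close> with \<open>z \<noteq> w\<close> is the
  only common point of two lines, so its image is determined by \<open>a\<close>; for \<open>z = w\<close> the claim
  follows because every other candidate for the image is already taken. Holomorphy of \<open>a\<close>
  is read off from the values of \<open>f\<close> at the points \<open>sp z z\<close>.
\<close>

lemma automorphism_of_sym_bidisc:
  assumes f: "f \<in> automorphisms sym_bidisc"
  obtains a where "a holomorphic_on ball 0 1" "bij_betw a (ball 0 1) (ball 0 1)"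
    "\<And>z w. z \<in> ball 0 1 \<Longrightarrow> w \<in> ball 0 1 \<Longrightarrow> f (sp z w) = sp (a z) (a w)"
proof -
  note fD = automorphismsD[OF f]
  let ?h = "inv_into sym_bidisc f"
  have hA: "?h \<in> automorphisms sym_bidisc" by (rule inverse_automorphism [OF f])
  obtain a where a: "\<And>z. z \<in> ball 0 1 \<Longrightarrow> a z \<in> ball 0 1"
    "\<And>z w. z \<in> ball 0 1 \<Longrightarrow> w \<in> ball 0 1 \<Longrightarrow> root_of (f (sp z w)) (a z)"
    using automorphism_line [OF f] by metis
  obtain b where b: "\<And>z. z \<in> ball 0 1 \<Longrightarrow> b z \<in> ball 0 1"
    "\<And>z w. z \<in> ball 0 1 \<Longrightarrow> w \<in> ball 0 1 \<Longrightarrow> root_of (?h (sp z w)) (b z)"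
    using automorphism_line [OF hA] by metis
  have ba: "b (a z) = z" if "z \<in> ball 0 1" for z
    by (rule automorphism_lines_inverse [OF f a(2) b(2) a(1) that])
  have ab: "a (b z) = z" if "z \<in> ball 0 1" for z
  proof (rule automorphism_lines_inverse [OF hA b(2) _ b(1) that])
    fix z w :: complex assume zw: "z \<in> ball 0 1" "w \<in> ball 0 1"
    hence "inv_into sym_bidisc ?h (sp z w) = f (sp z w)"
      using fD(1) by (intro inv_into_inv_into_eq) auto
    thus "root_of (inv_into sym_bidisc ?h (sp z w)) (a z)" using a(2) zw by simp
  qed
  have off: "f (sp z w) = sp (a z) (a w)" if zw: "z \<in> ball 0 1" "w \<in> ball 0 1" "z \<noteq> w" for z w
  proof -
    obtain u where u: "f (sp z w) = sp (a z) u" using root_of_imp_sp [OF a(2)] zw by blast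
    have "root_of (sp (a z) u) (a w)" using a(2)[OF zw(2,1)] unfolding sp_commute[of w z] u .
    moreover have "a z \<noteq> a w" using ba zw by metis
    ultimately show ?thesis using u by auto
  qed
  have diag: "f (sp z z) = sp (a z) (a z)" if z: "z \<in> ball 0 1" for z
  proof -
    obtain u where u: "f (sp z z) = sp (a z) u" using root_of_imp_sp [OF a(2)] z by blast
    have "f (sp z z) \<in> sym_bidisc" using fD(1) z by (auto simp: bij_betw_def)
    hence uB: "u \<in> ball 0 1" unfolding u by auto
    have "b u = z"
    proof (rule ccontr)
      assume "b u \<noteq> z"
      hence "f (sp z (b u)) = f (sp z z)" using off[OF z b(1)[OF uB]] ab[OF uB] u by auto
      hence "sp z (b u) = sp z z"
        by (rule inj_onD [OF bij_betw_imp_inj_on [OF fD(1)]]) (use z b(1)[OF uB] in auto)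
      with \<open>b u \<noteq> z\<close> show False by (simp add: sp_same_root)
    qed
    thus ?thesis using u ab[OF uB] by simp
  qed
  have diag_vec: "vector [2 * z, z * z] = sp z z" for z
    by (simp add: vec2_eq_iff)
  have "(\<lambda>z. f (vector [2 * z, z * z]) $ 1) holomorphic_on ball 0 1"
  proof (rule holomorphic_map_comp_disc [OF fD(2)])
    show "(\<lambda>z. 2 * z) holomorphic_on ball 0 1" "(\<lambda>z. z * z) holomorphic_on ball 0 (1::real)"
      by (intro holomorphic_intros)+
  qed (simp_all add: diag_vec)
  hence "(\<lambda>z. f (vector [2 * z, z * z]) $ 1 / 2) holomorphic_on ball 0 1"
    by (rule holomorphic_on_divide [OF _ holomorphic_on_const]) simp
  hence "a holomorphic_on ball 0 1"
  proof (rule holomorphic_transform)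
    fix z :: complex assume "z \<in> ball 0 1"
    from diag[OF this] show "f (vector [2 * z, z * z]) $ 1 / 2 = a z" 
      by (simp add: diag_vec)
  qed
  moreover have "bij_betw a (ball 0 1) (ball 0 1)"
    by (rule bij_betw_byWitness [of _ b]) (use a(1) b(1) ab ba in blast)+
  moreover have "f (sp z w) = sp (a z) (a w)" if "z \<in> ball 0 1" "w \<in> ball 0 1" for z w
    using that by (cases "z = w") (simp_all add: off diag)
  ultimately show ?thesis by (rule that)
qed

section \<open>An invariant of the orbits\<close>

text \<open>
  This is Schwarz's lemma for \<open>a\<close> conjugated by the Moebius maps that move \<open>w\<close> and \<open>a w\<close> to
  the origin. It is stated without quotients, as needed for the comparison of \<open>discr\<close> and
  \<open>gap\<close> below.
\<close>

lemma Schwarz_Pick: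
  assumes hol: "a holomorphic_on ball 0 1" and ball: "\<And>z. z \<in> ball 0 1 \<Longrightarrow> a z \<in> ball 0 1"
    and z: "z \<in> ball 0 1" and w: "w \<in> ball 0 1"
  shows "norm (a z - a w) * norm (1 - cnj w * z) \<le> norm (z - w) * norm (1 - cnj (a w) * a z)"
proof -
  define M where "M = Moebius_function 0"
  have inv: "M (- c) (M c x) = x" "M c (M (- c) x) = x" if "norm c < 1" "norm x < 1" for c x
    unfolding M_def using that by (simp_all add: Moebius_function_compose)
  have Mlt: "norm (M c x) < 1" if "norm c < 1" "norm x < 1" for c x
    unfolding M_def using that by (rule Moebius_function_norm_lt_1)
  have Mhol: "M c holomorphic_on ball 0 1" if "norm c < 1" for c
    unfolding M_def using that by (rule Moebius_function_holomorphic)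
  define h where "h = M (a w) \<circ> a \<circ> M (- w)"
  have w': "norm w < 1" "norm (- w) < 1" "norm (a w) < 1" using w ball[OF w] by auto
  have "norm (h (M w z)) \<le> norm (M w z)"
  proof (rule Schwarz_Lemma(1))
    show "h holomorphic_on ball 0 1"
      unfolding h_def
    proof (rule holomorphic_on_compose_gen)
      show "M (- w) holomorphic_on ball 0 1" "M (- w) ` ball 0 1 \<subseteq> ball 0 1"
        using Mhol Mlt w' by auto
      show "M (a w) \<circ> a holomorphic_on ball 0 1"
        by (rule holomorphic_on_compose_gen [OF hol Mhol]) (use ball w' in auto)
    qed
    show "h 0 = 0" by (simp add: h_def M_def Moebius_function_of_zero Moebius_function_eq_zero)
    show "norm (h x) < 1" if "norm x < 1" for x
      unfolding h_def o_def using w' that ball by (intro Mlt) (auto simp: Mlt)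
    show "norm (M w z) < 1" using w' z by (intro Mlt) auto
  qed
  also have "h (M w z) = M (a w) (a z)" using inv(1)[of w z] w' z by (simp add: h_def)
  finally have le: "norm (a z - a w) / norm (1 - cnj (a w) * a z) \<le> norm (z - w) / norm (1 - cnj w * z)"
    by (simp add: M_def Moebius_function_simple norm_divide)
  have "norm (1 - cnj (a w) * a z) > 0" "norm (1 - cnj w * z) > 0"
    using one_minus_mult_nonzero[of "cnj _"] w' z ball by auto
  thus ?thesis using le by (simp add: field_simps)
qed

definition discr :: "complex^2 \<Rightarrow> complex" where
  "discr x = (x$1)\<^sup>2 - 4 * x$2"

text \<open>
  In terms of the roots this is \<open>2 \<bar>1 - cnj w z\<bar>\<^sup>2 - \<bar>z - w\<bar>\<^sup>2\<close>. Hence \<open>\<bar>discr\<bar> / gap\<close> is a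
  function of the pseudo-hyperbolic distance of the two roots, while both numerator and
  denominator are elementary in the coordinates of the point.
\<close>

definition gap :: "complex^2 \<Rightarrow> real" where
  "gap x = 2 + 2 * (norm (x$2))\<^sup>2 - (norm (x$1))\<^sup>2"

lemma discr_sp: "discr (sp z w) = (z - w)\<^sup>2"
  by (simp add: discr_def power2_eq_square algebra_simps)

lemma gap_sp: "gap (sp z w) = 2 * (norm (1 - cnj w * z))\<^sup>2 - (norm (z - w))\<^sup>2"
proof -
  have "complex_of_real (gap (sp z w)) = of_real (2 * (norm (1 - cnj w * z))\<^sup>2 - (norm (z - w))\<^sup>2)"
    unfolding gap_def of_real_diff of_real_add of_real_mult complex_norm_square 
    by (simp add: algebra_simps)
  thus ?thesis by (simp only: of_real_eq_iff)
qed

lemma gap_minus_norm_discr_sp: 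
  "gap (sp z w) - norm (discr (sp z w)) = 2 * (1 - (norm z)\<^sup>2) * (1 - (norm w)\<^sup>2)"
proof -
  have "complex_of_real (gap (sp z w) - (norm (z - w))\<^sup>2) = of_real (2 * (1 - (norm z)\<^sup>2) * (1 - (norm w)\<^sup>2))"
    unfolding gap_def of_real_diff of_real_add of_real_mult complex_norm_square 
    by (simp add: algebra_simps)
  hence "gap (sp z w) - (norm (z - w))\<^sup>2 = 2 * (1 - (norm z)\<^sup>2) * (1 - (norm w)\<^sup>2)"
    by (simp only: of_real_eq_iff)
  thus ?thesis by (simp add: discr_sp norm_power)
qed

lemma norm_discr_less_gap: 
  assumes "x \<in> sym_bidisc" shows "norm (discr x) < gap x"
proof -
  obtain z w where zw: "norm z < 1" "norm w < 1" "x = sp z w" using assms mem_sym_bidisc by blast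
  have "(norm z)\<^sup>2 < 1" "(norm w)\<^sup>2 < 1" using zw by (simp_all add: abs_square_less_1)
  hence "0 < 2 * (1 - (norm z)\<^sup>2) * (1 - (norm w)\<^sup>2)" by simp
  thus ?thesis using gap_minus_norm_discr_sp[of z w] zw(3) by simp
qed

lemma automorphism_discr_gap_le:
  assumes f: "f \<in> automorphisms sym_bidisc" and x: "x \<in> sym_bidisc"
  shows "norm (discr (f x)) * gap x \<le> norm (discr x) * gap (f x)"
proof -
  obtain z w where "norm z < 1" "norm w < 1" and xzw: "x = sp z w" using x mem_sym_bidisc by blast
  hence zw: "z \<in> ball 0 1" "w \<in> ball 0 1" by auto
  obtain a where a: "a holomorphic_on ball 0 1" "bij_betw a (ball 0 1) (ball 0 1)"
    "\<And>z w. z \<in> ball 0 1 \<Longrightarrow> w \<in> ball 0 1 \<Longrightarrow> f (sp z w) = sp (a z) (a w)"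
    using automorphism_of_sym_bidisc [OF f] by blast
  have "norm (a z - a w) * norm (1 - cnj w * z) \<le> norm (z - w) * norm (1 - cnj (a w) * a z)"
    by (rule Schwarz_Pick [OF a(1) _ zw]) (use a(2) in \<open>auto simp: bij_betw_def\<close>)
  hence "(norm (a z - a w) * norm (1 - cnj w * z))\<^sup>2 \<le> (norm (z - w) * norm (1 - cnj (a w) * a z))\<^sup>2"
    by (intro power_mono) auto
  thus ?thesis unfolding xzw a(3)[OF zw] gap_sp discr_sp norm_power
    by (simp add: power_mult_distrib algebra_simps)
qed

text \<open>
  By the Schwarz-Pick lemma an automorphism does not increase \<open>\<bar>discr\<bar> / gap\<close>; neither
  does its inverse.
\<close>

lemma Orb_discr_gap:
  assumes x: "x \<in> sym_bidisc" and y: "y \<in> Orb x"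
  shows "norm (discr y) * gap x = norm (discr x) * gap y"
proof -
  obtain f where f: "f \<in> automorphisms sym_bidisc" "y = f x" using y unfolding Orb_def by blast
  note fD = automorphismsD[OF f(1)]
  have "y \<in> sym_bidisc" "inv_into sym_bidisc f y = x"
    using fD(1) x f(2) by (auto simp: bij_betw_def)
  with automorphism_discr_gap_le [OF f(1) x] automorphism_discr_gap_le [OF inverse_automorphism [OF f(1)], of y]
  show ?thesis by (simp add: f(2))
qed

section \<open>Tangent vectors of orbits lie in a real hyperplane\<close>

lemma has_vector_derivative_constant_imp_0:
  assumes "(g has_vector_derivative d) (at 0)" "\<epsilon> > 0" "\<And>t. t \<in> {-\<epsilon><..<\<epsilon>::real} \<Longrightarrow> g t = c"
  shows "d = 0"
proof -
  have "(g has_vector_derivative 0) (at 0)"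
    by (rule has_vector_derivative_transform_within_open [where f="\<lambda>_. c" and S="{-\<epsilon><..<\<epsilon>}"])
       (use assms in auto)
  thus ?thesis using assms(1) vector_derivative_unique_at by blast
qed

text \<open>
  Differentiating the invariance of \<open>\<bar>discr\<bar> / gap\<close> along a curve in the orbit gives one
  real linear equation for its velocity. If \<open>discr x = 0\<close> then \<open>\<bar>discr\<bar>\<close> is not
  differentiable at \<open>x\<close>, but then \<open>discr\<close> itself vanishes on the orbit, and its differential
  is used instead. Otherwise the equation is nontrivial because its second coefficient
  vanishes only if \<open>gap x = \<bar>discr x\<bar> \<bar>x\<^sub>2\<bar>\<close>, and this contradicts \<open>\<bar>discr x\<bar> < gap x\<close>.
\<close>

lemma tangent_space_Orb_hyperplane:
  assumes x: "x \<in> sym_bidisc"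
  obtains l m where "l \<noteq> 0 \<or> m \<noteq> 0" 
    "\<And>v. v \<in> tangent_space (Orb x) x \<Longrightarrow> Re (l * v$1 + m * v$2) = 0"
proof -
  have gpos: "gap x > 0" using norm_discr_less_gap[OF x] norm_ge_zero[of "discr x"] by linarith
  have curve: "\<exists>\<gamma> \<epsilon>. \<epsilon> > 0 \<and> (\<forall>t\<in>{-\<epsilon><..<\<epsilon>}. \<gamma> t \<in> Orb x) \<and> \<gamma> 0 = x \<and>
      ((\<lambda>t. \<gamma> t $ 1) has_vector_derivative v$1) (at 0) \<and> ((\<lambda>t. \<gamma> t $ 2) has_vector_derivative v$2) (at 0)"
    if v: "v \<in> tangent_space (Orb x) x" for v
  proof -
    obtain \<gamma> \<epsilon> where "\<epsilon> > 0" "\<gamma> ` {-\<epsilon><..<\<epsilon>} \<subseteq> Orb x" "\<gamma> 0 = x" and d: "(\<gamma> has_vector_derivative v) (at 0)"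
      using v unfolding tangent_space_def by blast
    moreover have "((\<lambda>t. \<gamma> t $ i) has_vector_derivative v$i) (at 0)" for i
      by (rule bounded_linear.has_vector_derivative [OF bounded_linear_vec_nth d])
    ultimately show ?thesis by blast
  qed
  show thesis
  proof (cases "discr x = 0")
    case True
    show ?thesis
    proof (rule that [of "2 * x$1" "-4"])
      fix v assume "v \<in> tangent_space (Orb x) x"
      then obtain \<gamma> \<epsilon> where \<epsilon>: "\<epsilon> > 0" and orb: "\<And>t. t \<in> {-\<epsilon><..<\<epsilon>} \<Longrightarrow> \<gamma> t \<in> Orb x" and 0: "\<gamma> 0 = x"
        and d: "((\<lambda>t. \<gamma> t $ 1) has_vector_derivative v$1) (at 0)" "((\<lambda>t. \<gamma> t $ 2) has_vector_derivative v$2) (at 0)"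
        using curve by blast
      have "((\<lambda>t. discr (\<gamma> t)) has_vector_derivative (2 * x$1 * v$1 - 4 * v$2)) (at 0)"
        unfolding discr_def power2_eq_square by (rule derivative_eq_intros d | simp add: 0)+
      hence "2 * x$1 * v$1 - 4 * v$2 = 0"
      proof (rule has_vector_derivative_constant_imp_0 [OF _ \<epsilon>])
        fix t assume "t \<in> {-\<epsilon><..<\<epsilon>}"
        from Orb_discr_gap [OF x orb [OF this]] True gpos show "discr (\<gamma> t) = 0" by simp
      qed
      hence "2 * x$1 * v$1 + (-4) * v$2 = 0" by simp
      thus "Re (2 * x$1 * v$1 + (-4) * v$2) = 0" by (simp only: zero_complex.sel)
    qed auto
  next
    case False
    let ?D = "discr x" and ?g = "gap x"
    define l where "l = 2 * of_real ?g * x$1 * cnj ?D + 2 * of_real ((norm ?D)\<^sup>2) * cnj (x$1)"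
    define m where "m = - 4 * of_real ?g * cnj ?D - 4 * of_real ((norm ?D)\<^sup>2) * cnj (x$2)"
    have "m \<noteq> 0"
    proof
      assume "m = 0"
      have "m = - 4 * (of_real ?g * cnj ?D + of_real ((norm ?D)\<^sup>2) * cnj (x$2))"
        by (simp add: m_def algebra_simps)
      with \<open>m = 0\<close> have "of_real ?g * cnj ?D + of_real ((norm ?D)\<^sup>2) * cnj (x$2) = 0"
        by (metis mult_eq_0_iff neg_equal_0_iff_equal zero_neq_numeral)
      hence "of_real ?g * cnj ?D = - (of_real ((norm ?D)\<^sup>2) * cnj (x$2))" 
        by (simp only: eq_neg_iff_add_eq_0)
      hence "norm (of_real ?g * cnj ?D) = norm (of_real ((norm ?D)\<^sup>2) * cnj (x$2))" by simp
      hence "?g * norm ?D = norm ?D * norm ?D * norm (x$2)"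
        using gpos by (simp only: norm_mult norm_of_real complex_mod_cnj power2_eq_square) simp
      hence "?g = norm ?D * norm (x$2)" using False by simp
      also have "\<dots> \<le> norm ?D * 1"
        using norm_components_sym_bidisc(2)[OF x] by (intro mult_left_mono) auto
      finally show False using norm_discr_less_gap[OF x] by simp
    qed
    moreover have "Re (l * v$1 + m * v$2) = 0" if v: "v \<in> tangent_space (Orb x) x" for v
    proof -
      obtain \<gamma> \<epsilon> where \<epsilon>: "\<epsilon> > 0" and orb: "\<And>t. t \<in> {-\<epsilon><..<\<epsilon>} \<Longrightarrow> \<gamma> t \<in> Orb x" and 0: "\<gamma> 0 = x"
        and d: "((\<lambda>t. \<gamma> t $ 1) has_vector_derivative v$1) (at 0)" "((\<lambda>t. \<gamma> t $ 2) has_vector_derivative v$2) (at 0)"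
        using curve[OF v] by blast
      note dc = d[THEN has_vector_derivative_cnj]
      define D' where "D' = 2 * x$1 * v$1 - 4 * v$2"
      define g' where "g' = 2 * (v$2 * cnj (x$2) + x$2 * cnj (v$2)) - (v$1 * cnj (x$1) + x$1 * cnj (v$1))"
      have dD: "((\<lambda>t. discr (\<gamma> t)) has_vector_derivative D') (at 0)"
        unfolding discr_def power2_eq_square D'_def by (rule derivative_eq_intros d | simp add: 0)+
      have dg: "((\<lambda>t. complex_of_real (gap (\<gamma> t))) has_vector_derivative g') (at 0)"
        unfolding gap_def of_real_diff of_real_add of_real_mult complex_norm_square g'_def
        by (rule derivative_eq_intros d dc | simp add: 0)+
      \<comment> \<open>squaring removes the norms, so that the invariance becomes a polynomial identity in the coordinates and their conjugates\<close>
      let ?E = "\<lambda>t. discr (\<gamma> t) * cnj (discr (\<gamma> t)) * of_real ?g * of_real ?g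
          - of_real ((norm ?D)\<^sup>2) * (of_real (gap (\<gamma> t)) * of_real (gap (\<gamma> t)))"
      have "(?E has_vector_derivative ((D' * cnj ?D + ?D * cnj D') * of_real ?g * of_real ?g
          - of_real ((norm ?D)\<^sup>2) * (2 * of_real ?g * g'))) (at 0)"
        by (rule derivative_eq_intros dD dg dD[THEN has_vector_derivative_cnj] refl | simp add: 0 algebra_simps)+
      hence "(D' * cnj ?D + ?D * cnj D') * of_real ?g * of_real ?g
          - of_real ((norm ?D)\<^sup>2) * (2 * of_real ?g * g') = 0"
      proof (rule has_vector_derivative_constant_imp_0 [OF _ \<epsilon>])
        fix t assume "t \<in> {-\<epsilon><..<\<epsilon>}"
        from Orb_discr_gap [OF x orb [OF this]]
        have "(norm (discr (\<gamma> t)) * ?g)\<^sup>2 = (norm ?D * gap (\<gamma> t))\<^sup>2" by simp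
        hence "complex_of_real ((norm (discr (\<gamma> t)))\<^sup>2) * (of_real ?g * of_real ?g) = 
            of_real ((norm ?D)\<^sup>2) * (of_real (gap (\<gamma> t)) * of_real (gap (\<gamma> t)))"
          by (simp only: of_real_eq_iff power2_eq_square mult_ac flip: of_real_mult)
        thus "?E t = 0" unfolding complex_norm_square by (simp add: mult_ac)
      qed
      hence "complex_of_real ?g * ((D' * cnj ?D + ?D * cnj D') * of_real ?g
          - of_real ((norm ?D)\<^sup>2) * (2 * g')) = 0" by (simp add: algebra_simps)
      hence "(D' * cnj ?D + ?D * cnj D') * of_real ?g - of_real ((norm ?D)\<^sup>2) * (2 * g') = 0" 
        using gpos by simp
      moreover have "(D' * cnj ?D + ?D * cnj D') * of_real ?g - of_real ((norm ?D)\<^sup>2) * (2 * g')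
         = (l * v$1 + m * v$2) + cnj (l * v$1 + m * v$2)"
        by (simp add: D'_def g'_def l_def m_def algebra_simps)
      ultimately have "complex_of_real (2 * Re (l * v$1 + m * v$2)) = 0"
        by (simp only: complex_add_cnj)
      hence "2 * Re (l * v$1 + m * v$2) = 0" by (simp only: of_real_eq_0_iff)
      thus ?thesis by (metis mult_eq_0_iff zero_neq_numeral)
    qed
    ultimately show ?thesis using that by blast
  qed
qed

lemma complex_line_span:
  fixes V :: "(complex^2) set"
  assumes "vec.subspace V" "vec.dim V = 1"
  obtains v where "v \<noteq> 0" "V = vec.span {v}"
proof -
  obtain B where B: "B \<subseteq> V" "vec.independent B" "V \<subseteq> vec.span B" "card B = vec.dim V"
    using vec.basis_exists by blast
  then obtain v where v: "B = {v}" using assms(2) by (metis card_1_singletonE)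
  have "v \<noteq> 0" using B(2) v vec.dependent_zero by blast
  moreover have "V = vec.span {v}" using B v assms(1) vec.span_minimal by blast
  ultimately show ?thesis using that by blast
qed

text \<open>
  On a complex subspace the real part of a complex linear form vanishes only if the form
  itself does, as one sees by replacing \<open>v\<close> with \<open>\<i> v\<close>. So a complex line in the hyperplane
  is the kernel of the form.
\<close>

lemma complex_line_in_real_hyperplane_unique:
  fixes V W :: "(complex^2) set"
  assumes lm: "l \<noteq> 0 \<or> m \<noteq> 0" and T: "\<And>v. v \<in> T \<Longrightarrow> Re (l * v$1 + m * v$2) = 0"
    and V: "vec.subspace V" "vec.dim V = 1" "V \<subseteq> T" 
    and W: "vec.subspace W" "vec.dim W = 1" "W \<subseteq> T"
  shows "V = W"
proof -
  have ker: "l * v$1 + m * v$2 = 0" if "vec.subspace U" "U \<subseteq> T" "v \<in> U" for U v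
  proof (rule complex_eqI)
    have "\<i> *s v \<in> U" using that vec.subspace_scale by blast
    hence "Re (l * (\<i> *s v)$1 + m * (\<i> *s v)$2) = 0" using T that by blast
    thus "Im (l * v$1 + m * v$2) = Im 0" by (simp add: algebra_simps)
  qed (use T that in auto)
  obtain v where v: "v \<noteq> 0" "V = vec.span {v}" using complex_line_span V by blast
  obtain w where w: "w \<noteq> 0" "W = vec.span {w}" using complex_line_span W by blast
  have kv: "l * v$1 + m * v$2 = 0" and kw: "l * w$1 + m * w$2 = 0"
    using ker V W v w vec.span_base by blast+
  have "l * (v$1 * w$2 - v$2 * w$1) = (l * v$1 + m * v$2) * w$2 - (l * w$1 + m * w$2) * v$2"
    "m * (v$1 * w$2 - v$2 * w$1) = (l * w$1 + m * w$2) * v$1 - (l * v$1 + m * v$2) * w$1"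
    by (simp_all add: algebra_simps)
  hence det: "v$1 * w$2 = v$2 * w$1" using kv kw lm by auto
  have "\<exists>c. v = c *s w"
  proof (cases "w$1 = 0")
    case True
    hence "w$2 \<noteq> 0" using w by (auto simp: vec2_eq_iff)
    thus ?thesis using det True by (intro exI[of _ "v$2 / w$2"]) (auto simp: vec2_eq_iff)
  next
    case False
    thus ?thesis using det by (intro exI[of _ "v$1 / w$1"]) (auto simp: vec2_eq_iff field_simps)
  qed
  then obtain c where c: "v = c *s w" by blast
  hence "c \<noteq> 0" using v by auto
  hence "w = (1 / c) *s v" by (simp add: c)
  hence "v \<in> W" "w \<in> V" using c v w by (metis vec.span_base vec.span_scale insertI1)+
  thus ?thesis using v w V W vec.span_minimal by blast
qed

section \<open>Automorphisms induced by Moebius maps\<close>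

definition disc_moebius :: "complex \<Rightarrow> complex \<Rightarrow> complex \<Rightarrow> complex" where
  "disc_moebius e w z = e * (z - w) / (1 - cnj w * z)"

text \<open>
  The coefficients of the polynomial whose roots are the images of the roots of \<open>x\<close> under
  \<open>disc_moebius e w\<close>. Writing them as rational functions of the coordinates of \<open>x\<close> makes
  holomorphy evident.
\<close>

definition sym_moebius :: "complex \<Rightarrow> complex \<Rightarrow> complex^2 \<Rightarrow> complex^2" where
  "sym_moebius e w x = vector 
     [e * (x$1 - 2 * w - 2 * cnj w * x$2 + w * cnj w * x$1) / (1 - cnj w * x$1 + (cnj w)\<^sup>2 * x$2),
      e\<^sup>2 * (x$2 - w * x$1 + w\<^sup>2) / (1 - cnj w * x$1 + (cnj w)\<^sup>2 * x$2)]"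

lemma denominator_factor: "1 - c * (z + w) + c\<^sup>2 * (z * w) = (1 - c * z) * (1 - c * w)" for c :: complex
  by (simp add: power2_eq_square algebra_simps)

lemma norm_disc_moebius_less_1:
  assumes "norm e = 1" "norm w < 1" "norm z < 1"
  shows "norm (disc_moebius e w z) < 1"
proof -
  have "norm (disc_moebius e w z) = norm (Moebius_function 0 w z)"
    using assms(1) by (simp add: disc_moebius_def Moebius_function_simple norm_mult norm_divide)
  thus ?thesis using Moebius_function_norm_lt_1 assms by simp
qed

lemma disc_moebius_inverse:
  assumes e: "norm e = 1" and w: "norm w < 1" and z: "norm z < 1"
  shows "disc_moebius (cnj e) (- e * w) (disc_moebius e w z) = z"
proof -
  have ee: "e * cnj e = 1" using e by (simp flip: complex_norm_square)
  have nz: "1 - cnj w * z \<noteq> 0" "1 - cnj w * w \<noteq> 0"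
    using one_minus_mult_nonzero[of "cnj w"] w z by simp_all
  let ?m = "disc_moebius e w z"
  have m: "?m * (1 - cnj w * z) = e * (z - w)" using nz by (simp add: disc_moebius_def)
  have "cnj e * (?m + e * w) * (1 - cnj w * z) = cnj e * (?m * (1 - cnj w * z)) + (e * cnj e) * w * (1 - cnj w * z)"
    by (simp add: algebra_simps)
  also have "\<dots> = (e * cnj e) * (z - w) + (e * cnj e) * w * (1 - cnj w * z)"
    unfolding m by (simp add: algebra_simps)
  also have "\<dots> = z * (1 - cnj w * w)" unfolding ee by (simp add: algebra_simps)
  finally have num: "cnj e * (?m + e * w) * (1 - cnj w * z) = z * (1 - cnj w * w)" .
  have "(1 + cnj e * cnj w * ?m) * (1 - cnj w * z) = (1 - cnj w * z) + cnj e * cnj w * (?m * (1 - cnj w * z))"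
    by (simp add: algebra_simps)
  also have "\<dots> = (1 - cnj w * z) + (e * cnj e) * cnj w * (z - w)"
    unfolding m by (simp add: algebra_simps)
  also have "\<dots> = 1 - cnj w * w" unfolding ee by (simp add: algebra_simps)
  finally have den: "(1 + cnj e * cnj w * ?m) * (1 - cnj w * z) = 1 - cnj w * w" .
  have "disc_moebius (cnj e) (- e * w) ?m = cnj e * (?m + e * w) / (1 + cnj e * cnj w * ?m)"
    by (simp add: disc_moebius_def)
  also have "\<dots> = (cnj e * (?m + e * w) * (1 - cnj w * z)) / ((1 + cnj e * cnj w * ?m) * (1 - cnj w * z))"
    using nz by simp
  also have "\<dots> = z" unfolding num den using nz by simp
  finally show ?thesis .
qed

lemma sym_moebius_sp:
  assumes "norm w < 1" "norm z < 1" "norm z' < 1"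
  shows "sym_moebius e w (sp z z') = sp (disc_moebius e w z) (disc_moebius e w z')"
proof -
  have "1 - cnj w * z \<noteq> 0" "1 - cnj w * z' \<noteq> 0"
    using one_minus_mult_nonzero[of "cnj w"] assms by simp_all
  thus ?thesis
    unfolding vec2_eq_iff sym_moebius_def disc_moebius_def
    by (simp add: denominator_factor) (simp add: field_simps power2_eq_square)
qed

lemma sym_moebius_in_sym_bidisc:
  assumes "norm e = 1" "norm w < 1" "x \<in> sym_bidisc"
  shows "sym_moebius e w x \<in> sym_bidisc"
  using assms unfolding mem_sym_bidisc by (metis norm_disc_moebius_less_1 sym_moebius_sp)

lemma sym_moebius_inverse:
  assumes "norm e = 1" "norm w < 1" "x \<in> sym_bidisc"
  shows "sym_moebius (cnj e) (- e * w) (sym_moebius e w x) = x"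
proof -
  obtain z z' where z: "norm z < 1" "norm z' < 1" "x = sp z z'" using assms(3) mem_sym_bidisc by blast
  have "norm (- e * w) < 1" using assms by (simp add: norm_mult)
  hence "sym_moebius (cnj e) (- e * w) (sp (disc_moebius e w z) (disc_moebius e w z')) = sp z z'"
    using assms z by (subst sym_moebius_sp) (simp_all only: norm_disc_moebius_less_1 disc_moebius_inverse)
  thus ?thesis using assms z by (simp only: sym_moebius_sp)
qed

text \<open>
  The coordinates are quotients of affine functions of \<open>x\<close> whose common denominator
  factors as \<open>(1 - cnj w z) (1 - cnj w z')\<close> at \<open>sp z z'\<close>.
\<close>

lemma holomorphic_sym_moebius:
  assumes "norm w < 1"
  shows "holomorphic_map_on (sym_moebius e w) sym_bidisc"
  unfolding holomorphic_map_on_def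
proof
  fix x assume "x \<in> sym_bidisc"
  then obtain z z' where z: "norm z < 1" "norm z' < 1" "x = sp z z'" using mem_sym_bidisc by blast
  define D where "D = (\<lambda>x :: complex^2. 1 - cnj w * x$1 + (cnj w)\<^sup>2 * x$2)"
  define D' where "D' = (\<lambda>h :: complex^2. - (cnj w * h$1) + (cnj w)\<^sup>2 * h$2)"
  define N where "N = (\<lambda>x :: complex^2. e * (x$1 - 2 * w - 2 * cnj w * x$2 + w * cnj w * x$1))"
  define N' where "N' = (\<lambda>h :: complex^2. e * (h$1 - 2 * cnj w * h$2 + w * cnj w * h$1))"
  define P where "P = (\<lambda>x :: complex^2. e\<^sup>2 * (x$2 - w * x$1 + w\<^sup>2))"
  define P' where "P' = (\<lambda>h :: complex^2. e\<^sup>2 * (h$2 - w * h$1))"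
  have nz: "D x \<noteq> 0"
    using one_minus_mult_nonzero[of "cnj w"] assms z by (simp add: D_def denominator_factor)
  note nth = bounded_linear.has_derivative [OF bounded_linear_vec_nth has_derivative_ident]
  have d: "(D has_derivative D') (at x within sym_bidisc)" 
    "(N has_derivative N') (at x within sym_bidisc)" "(P has_derivative P') (at x within sym_bidisc)"
    unfolding D_def D'_def N_def N'_def P_def P'_def
    by (rule derivative_eq_intros nth refl | simp)+
  let ?f' = "\<lambda>h. vector [(N' h * D x - N x * D' h) / (D x * D x), (P' h * D x - P x * D' h) / (D x * D x)] :: complex^2"
  have "((\<lambda>x. vector [N x / D x, P x / D x] :: complex^2) has_derivative ?f') (at x within sym_bidisc)"
    by (intro has_derivative_vector2 has_derivative_divide' d nz)
  moreover have "sym_moebius e w = (\<lambda>x. vector [N x / D x, P x / D x])"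
    by (simp add: sym_moebius_def D_def N_def P_def fun_eq_iff)
  moreover have "Vector_Spaces.linear (*s) (*s) ?f'"
    unfolding Vector_Spaces.linear_iff
  proof (intro conjI allI vec.vector_space_axioms)
    fix h k :: "complex^2" and c :: complex
    show "?f' (h + k) = ?f' h + ?f' k" "?f' (c *s h) = c *s ?f' h"
      using nz by (simp_all add: vec2_eq_iff D'_def N'_def P'_def divide_simps) (simp_all add: algebra_simps)
  qed
  ultimately show "\<exists>f'. (sym_moebius e w has_derivative f') (at x within sym_bidisc) \<and> Vector_Spaces.linear (*s) (*s) f'"
    by auto
qed

lemma sym_moebius_automorphism:
  assumes e: "norm e = 1" and w: "norm w < 1"
  shows "sym_moebius e w \<in> automorphisms sym_bidisc"
proof -
  let ?f = "sym_moebius e w" and ?g = "sym_moebius (cnj e) (- e * w)"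
  have ee: "e * cnj e = 1" using e by (simp flip: complex_norm_square)
  have ew: "norm (cnj e) = 1" "norm (- e * w) < 1" using e w by (simp_all add: norm_mult)
  have gf: "?g (?f x) = x" if "x \<in> sym_bidisc" for x
    using sym_moebius_inverse e w that by blast
  have fg: "?f (?g x) = x" if "x \<in> sym_bidisc" for x
  proof -
    have "- cnj e * (- e * w) = (e * cnj e) * w" by simp
    hence "- cnj e * (- e * w) = w" by (simp only: ee mult_1)
    thus ?thesis using sym_moebius_inverse[OF ew that] by (simp only: complex_cnj_cnj)
  qed
  have bij: "bij_betw ?f sym_bidisc sym_bidisc"
  proof (rule bij_betw_byWitness [of _ ?g])
    show "?f ` sym_bidisc \<subseteq> sym_bidisc" "?g ` sym_bidisc \<subseteq> sym_bidisc"
      using sym_moebius_in_sym_bidisc[OF e w] sym_moebius_in_sym_bidisc[OF ew] by blast+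
  qed (use gf fg in blast)+
  have "inv_into sym_bidisc ?f x = ?g x" if "x \<in> sym_bidisc" for x
    by (rule inv_into_f_eq [OF bij_betw_imp_inj_on [OF bij] sym_moebius_in_sym_bidisc [OF ew that] fg [OF that]])
  hence "holomorphic_map_on (inv_into sym_bidisc ?f) sym_bidisc"
    using holomorphic_map_on_cong holomorphic_sym_moebius[OF ew(2)] by metis
  thus ?thesis using bij holomorphic_sym_moebius[OF w] by (simp add: automorphisms_def)
qed

section \<open>Velocities of curves\<close>

lemma holomorphic_restrict_real_C1:
  assumes h: "h holomorphic_on U" "open U" and I: "\<And>t. t \<in> I \<Longrightarrow> complex_of_real t \<in> U"
  shows "continuous_on I (\<lambda>t. deriv h (of_real t))"
    and "t \<in> I \<Longrightarrow> ((\<lambda>t. h (of_real t)) has_vector_derivative deriv h (of_real t)) (at t)"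
proof -
  have "deriv h holomorphic_on U" using h by (rule holomorphic_deriv)
  hence "continuous_on U (deriv h)" by (rule holomorphic_on_imp_continuous_on)
  thus "continuous_on I (\<lambda>t. deriv h (of_real t))"
    by (rule continuous_on_compose2) (use I in \<open>auto intro!: continuous_intros\<close>)
  assume "t \<in> I"
  hence "(h has_field_derivative deriv h (of_real t)) (at (of_real t))"
    using I h by (metis holomorphic_derivI)
  thus "((\<lambda>t. h (of_real t)) has_vector_derivative deriv h (of_real t)) (at t)"
    by (rule has_vector_derivative_real_field)
qed

text \<open>
  The curves that are used below are restrictions to the real axis of holomorphic maps,
  for which continuity of the derivative is automatic.
\<close>

lemma tangent_space_holomorphic_curve:
  assumes h: "h1 holomorphic_on U" "h2 holomorphic_on U" "open U" 
    and \<epsilon>: "\<epsilon> > 0" and U: "\<And>t. t \<in> {-\<epsilon><..<\<epsilon>} \<Longrightarrow> complex_of_real t \<in> U"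
    and M: "\<And>t. t \<in> {-\<epsilon><..<\<epsilon>} \<Longrightarrow> vector [h1 (of_real t), h2 (of_real t)] \<in> M"
    and p: "vector [h1 0, h2 0] = p"
    and d: "(h1 has_field_derivative v1) (at 0)" "(h2 has_field_derivative v2) (at 0)"
  shows "(vector [v1, v2] :: complex^2) \<in> tangent_space M p"
proof -
  define \<gamma> where "\<gamma> = (\<lambda>t. vector [h1 (of_real t), h2 (of_real t)] :: complex^2)"
  define \<gamma>' where "\<gamma>' = (\<lambda>t. vector [deriv h1 (of_real t), deriv h2 (of_real t)] :: complex^2)"
  have v: "(\<gamma> has_vector_derivative \<gamma>' t) (at t)" if t: "t \<in> {-\<epsilon><..<\<epsilon>}" for t
  proof -
    have "((\<lambda>t. h1 (of_real t)) has_derivative (\<lambda>h. h *\<^sub>R deriv h1 (of_real t))) (at t)"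
      "((\<lambda>t. h2 (of_real t)) has_derivative (\<lambda>h. h *\<^sub>R deriv h2 (of_real t))) (at t)"
      using holomorphic_restrict_real_C1(2)[OF h(1,3) U t] holomorphic_restrict_real_C1(2)[OF h(2,3) U t]
      by (simp_all add: has_vector_derivative_def)
    from has_derivative_vector2 [OF this]
    have "(\<gamma> has_derivative (\<lambda>h. vector [h *\<^sub>R deriv h1 (of_real t), h *\<^sub>R deriv h2 (of_real t)])) (at t)"
      unfolding \<gamma>_def .
    moreover have "vector [h *\<^sub>R deriv h1 (of_real t), h *\<^sub>R deriv h2 (of_real t)] = h *\<^sub>R \<gamma>' t" for h
      by (simp add: vec2_eq_iff \<gamma>'_def)
    ultimately show ?thesis by (simp add: has_vector_derivative_def)
  qed
  have "continuous_on {-\<epsilon><..<\<epsilon>} (\<lambda>t. deriv h1 (of_real t))"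
    "continuous_on {-\<epsilon><..<\<epsilon>} (\<lambda>t. deriv h2 (of_real t))"
    using holomorphic_restrict_real_C1(1)[OF h(1,3) U] holomorphic_restrict_real_C1(1)[OF h(2,3) U] by blast+
  hence "continuous_on {-\<epsilon><..<\<epsilon>} \<gamma>'"
    unfolding continuous_on_def \<gamma>'_def by (auto intro!: tendsto_vector2)
  hence "\<gamma> C1_differentiable_on {-\<epsilon><..<\<epsilon>}"
    unfolding C1_differentiable_on_def using v by blast
  moreover have "(\<gamma> has_vector_derivative vector [v1, v2]) (at 0)"
    using v[of 0] \<epsilon> d by (simp add: \<gamma>'_def DERIV_imp_deriv)
  moreover have "\<gamma> ` {-\<epsilon><..<\<epsilon>} \<subseteq> M" using M by (auto simp: \<gamma>_def)
  moreover have "\<gamma> 0 = p" using p by (simp add: \<gamma>_def)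
  ultimately show ?thesis unfolding tangent_space_def using \<epsilon> by blast
qed

section \<open>The flat direction\<close>

text \<open>
  The real linear equation \<open>b + cnj b p = c\<close> for \<open>b\<close> is solved by Cramer's rule. It yields
  both the flat parameter of a point and the Moebius velocity that is needed for the
  sharp direction.
\<close>

lemma conjugate_linear_solution:
  fixes p c :: complex
  assumes "norm p < 1"
  defines "b \<equiv> (c - p * cnj c) / of_real (1 - (norm p)\<^sup>2)"
  shows "b + cnj b * p = c"
proof -
  define k where "k = 1 - (norm p)\<^sup>2"
  have k: "k > 0" using assms(1) by (simp add: k_def abs_square_less_1)
  have kc: "complex_of_real k = 1 - p * cnj p" 
    unfolding k_def of_real_diff complex_norm_square by simp
  have "(b + cnj b * p) * of_real k = (c - p * cnj c) + cnj (c - p * cnj c) * p"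
    using k by (simp add: b_def field_simps flip: k_def)
  also have "\<dots> = c * of_real k" unfolding kc by (simp add: algebra_simps)
  finally show ?thesis using k by simp
qed

lemma flat_parameter_exists:
  assumes x: "x \<in> sym_bidisc"
  obtains \<beta> where "norm \<beta> < 1" "x$1 = \<beta> + cnj \<beta> * x$2"
proof -
  obtain z w where zw: "norm z < 1" "norm w < 1" "x = sp z w" using x mem_sym_bidisc by blast
  let ?s = "x$1" and ?p = "x$2"
  have p1: "norm ?p < 1" by (rule norm_components_sym_bidisc [OF x])
  define k where "k = 1 - (norm ?p)\<^sup>2"
  define \<beta> where "\<beta> = (?s - ?p * cnj ?s) / of_real k"
  have k: "k > 0" using p1 by (simp add: k_def abs_square_less_1)
  have "0 < (1 - norm z) * (1 - norm w) * (1 - norm z * norm w)"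
    using zw p1 by (simp add: norm_mult)
  hence "norm (?s - ?p * cnj ?s) < k"
    using norm_flat_numerator_le[of z w] zw by (simp add: k_def)
  hence "norm \<beta> < 1" using k by (simp add: \<beta>_def norm_divide)
  moreover have "?s = \<beta> + cnj \<beta> * ?p"
    using conjugate_linear_solution[OF p1, of ?s] by (simp add: \<beta>_def k_def)
  ultimately show ?thesis by (rule that)
qed

lemma flat_parameter_unique:
  assumes "norm p < 1" "\<beta> + cnj \<beta> * p = \<beta>' + cnj \<beta>' * p"
  shows "\<beta> = \<beta>'"
proof (rule ccontr)
  assume ne: "\<beta> \<noteq> \<beta>'"
  have "\<beta> - \<beta>' = - (cnj (\<beta> - \<beta>') * p)" using assms(2) by (simp add: algebra_simps)
  hence "norm (\<beta> - \<beta>') = norm (\<beta> - \<beta>') * norm p" by (metis complex_mod_cnj norm_minus_cancel norm_mult)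
  thus False using assms(1) ne by simp
qed

lemma mem_flat_geodesic: "x \<in> flat_geodesic \<beta> \<longleftrightarrow> norm (x$2) < 1 \<and> x$1 = \<beta> + cnj \<beta> * x$2"
  unfolding flat_geodesic_def by (auto simp: vec2_eq_iff)

lemma flat_direction_contains:
  assumes x: "x \<in> sym_bidisc" and \<beta>: "norm \<beta> < 1" "x$1 = \<beta> + cnj \<beta> * x$2"
  shows "vector [cnj \<beta>, 1] \<in> flat_direction x"
proof -
  have p: "norm (x$2) < 1" by (rule norm_components_sym_bidisc [OF x])
  have "(THE F. F \<in> flat_geodesic ` ball 0 1 \<and> x \<in> F) = flat_geodesic \<beta>"
  proof (rule the_equality)
    show "flat_geodesic \<beta> \<in> flat_geodesic ` ball 0 1 \<and> x \<in> flat_geodesic \<beta>"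
      using \<beta> p by (auto simp: mem_flat_geodesic)
    fix F assume "F \<in> flat_geodesic ` ball 0 1 \<and> x \<in> F"
    then obtain \<beta>' where "F = flat_geodesic \<beta>'" "x \<in> flat_geodesic \<beta>'" by blast
    thus "F = flat_geodesic \<beta>" using flat_parameter_unique[OF p, of \<beta> \<beta>'] \<beta> by (simp add: mem_flat_geodesic)
  qed
  moreover have "vector [cnj \<beta>, 1] \<in> tangent_space (flat_geodesic \<beta>) x"
  proof (rule tangent_space_holomorphic_curve [where U = UNIV and \<epsilon> = "1 - norm (x$2)"
        and ?h1.0 = "\<lambda>t. \<beta> + cnj \<beta> * (x$2 + t)" and ?h2.0 = "\<lambda>t. x$2 + t"])
    fix t :: real assume t: "t \<in> {- (1 - norm (x$2))<..<1 - norm (x$2)}"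
    hence "norm (x$2 + of_real t) < 1"
      using norm_triangle_ineq[of "x$2" "of_real t"] by auto
    thus "vector [\<beta> + cnj \<beta> * (x$2 + of_real t), x$2 + of_real t] \<in> flat_geodesic \<beta>"
      by (simp add: mem_flat_geodesic)
  next
    show "((\<lambda>t. \<beta> + cnj \<beta> * (x$2 + t)) has_field_derivative cnj \<beta>) (at 0)"
      "((\<lambda>t. x$2 + t) has_field_derivative 1) (at 0)"
      by (rule derivative_eq_intros refl | simp)+
  qed (use p \<beta> in \<open>auto intro!: holomorphic_intros simp: vec2_eq_iff\<close>)
  ultimately show ?thesis by (simp add: flat_direction_def)
qed

section \<open>The sharp direction\<close>

text \<open>
  The curve consists of the images of \<open>x\<close> under the maps induced by
  \<open>z \<mapsto> exp (\<i> \<theta> t) (z + t \<alpha>) / (1 + t cnj \<alpha> z)\<close>. The infinitesimal generator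
  \<open>\<i> \<theta> z + \<alpha> - cnj \<alpha> z\<^sup>2\<close> of this family, applied to both roots, gives the velocity.
\<close>

lemma Moebius_orbit_velocity:
  assumes x: "x \<in> sym_bidisc"
  shows "vector [\<i> * of_real \<theta> * x$1 + 2 * \<alpha> + 2 * cnj \<alpha> * x$2 - cnj \<alpha> * (x$1)\<^sup>2,
          2 * \<i> * of_real \<theta> * x$2 + \<alpha> * x$1 - cnj \<alpha> * x$1 * x$2] \<in> tangent_space (Orb x) x"
proof -
  obtain z w where zw: "norm z < 1" "norm w < 1" "x = sp z w" using x mem_sym_bidisc by blast
  let ?s = "x$1" and ?p = "x$2"
  define D where "D t = 1 + t * cnj \<alpha> * ?s + t\<^sup>2 * (cnj \<alpha>)\<^sup>2 * ?p" for t :: complex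
  define e where "e t = exp (\<i> * of_real \<theta> * t)" for t :: complex
  define h1 where "h1 = (\<lambda>t. e t * (?s + 2 * t * \<alpha> + 2 * t * cnj \<alpha> * ?p + t\<^sup>2 * \<alpha> * cnj \<alpha> * ?s) / D t)"
  define h2 where "h2 = (\<lambda>t. (e t)\<^sup>2 * (?p + t * \<alpha> * ?s + t\<^sup>2 * \<alpha>\<^sup>2) / D t)"
  \<comment> \<open>keeps the Moebius parameter \<open>- t \<alpha>\<close> in the unit disc\<close>
  define \<epsilon> where "\<epsilon> = 1 / (norm \<alpha> + 1)"
  define U where "U = {t. D t \<noteq> 0}"
  have \<epsilon>: "\<epsilon> > 0" by (simp add: \<epsilon>_def add_nonneg_pos)
  have small: "norm (- (of_real t * \<alpha>)) < 1" if "t \<in> {-\<epsilon><..<\<epsilon>}" for t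
  proof -
    have "\<bar>t\<bar> * (norm \<alpha> + 1) < 1"
      using that by (auto simp: \<epsilon>_def field_simps abs_if add_pos_nonneg)
    thus ?thesis by (simp add: norm_mult algebra_simps)
  qed
  have D: "D (of_real t) \<noteq> 0" if "t \<in> {-\<epsilon><..<\<epsilon>}" for t
  proof -
    let ?c = "- (of_real t * cnj \<alpha>)"
    have "norm ?c < 1" using small[OF that] by (simp add: norm_mult)
    hence "(1 - ?c * z) * (1 - ?c * w) \<noteq> 0"
      using one_minus_mult_nonzero zw by (metis mult_eq_0_iff)
    also have "(1 - ?c * z) * (1 - ?c * w) = D (of_real t)"
      by (simp add: D_def zw power2_eq_square algebra_simps)
    finally show ?thesis .
  qed
  show ?thesis
  proof (rule tangent_space_holomorphic_curve [where U = U and \<epsilon> = \<epsilon> and ?h1.0 = h1 and ?h2.0 = h2])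
    show "h1 holomorphic_on U" "h2 holomorphic_on U"
      unfolding h1_def h2_def D_def e_def U_def by (intro holomorphic_intros; simp)+
    have "continuous_on UNIV D" unfolding D_def by (intro continuous_intros)
    hence "open (D -` (- {0}))" by (intro open_vimage) auto
    thus "open U" by (simp add: U_def vimage_def)
    show "\<epsilon> > 0" by (rule \<epsilon>)
    show "complex_of_real t \<in> U" if "t \<in> {-\<epsilon><..<\<epsilon>}" for t
      using D[OF that] by (simp add: U_def)
    show "vector [h1 0, h2 0] = x"
      by (simp add: vec2_eq_iff h1_def h2_def D_def e_def)
    fix t assume t: "t \<in> {-\<epsilon><..<\<epsilon>}"
    have "norm (e (of_real t)) = 1" by (simp add: e_def)
    hence "sym_moebius (e (of_real t)) (- (of_real t * \<alpha>)) x \<in> Orb x"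
      using sym_moebius_automorphism small[OF t] unfolding Orb_def by blast
    also have "sym_moebius (e (of_real t)) (- (of_real t * \<alpha>)) x = vector [h1 (of_real t), h2 (of_real t)]"
      unfolding vec2_eq_iff by (simp add: sym_moebius_def h1_def h2_def D_def power_mult_distrib mult_ac power2_eq_square)
    finally show "vector [h1 (of_real t), h2 (of_real t)] \<in> Orb x" .
  next
    show "(h1 has_field_derivative \<i> * of_real \<theta> * ?s + 2 * \<alpha> + 2 * cnj \<alpha> * ?p - cnj \<alpha> * ?s\<^sup>2) (at 0)"
      unfolding h1_def D_def e_def
      by (rule derivative_eq_intros refl | simp)+ (simp add: power2_eq_square algebra_simps)
    show "(h2 has_field_derivative 2 * \<i> * of_real \<theta> * ?p + \<alpha> * ?s - cnj \<alpha> * ?s * ?p) (at 0)"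
      unfolding h2_def D_def e_def
      by (rule derivative_eq_intros refl | simp)+
  qed
qed

text \<open>
  Since \<open>s\<^sup>2 - 2 p = s \<sqdot> s - p \<sqdot> 2\<close> and \<open>p s = s \<sqdot> 2 p - p \<sqdot> s\<close>, the velocity above equals
  \<open>A (2, s) + B (s, 2 p)\<close> with \<open>A = \<alpha> + cnj \<alpha> p\<close> and \<open>B = \<i> \<theta> - cnj \<alpha> s\<close>. Given \<open>c\<close>, the
  equation \<open>A = c\<close> determines \<open>\<alpha>\<close>, and \<open>s = \<beta> + cnj \<beta> p\<close> makes
  \<open>cnj \<alpha> s - cnj \<beta> c = cnj \<alpha> \<beta> - \<alpha> cnj \<beta>\<close> purely imaginary, so that \<open>\<theta>\<close> can be chosen real
  with \<open>B = - cnj \<beta> c\<close>.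
\<close>

lemma sharp_line_tangent:
  assumes x: "x \<in> sym_bidisc" and \<beta>: "x$1 = \<beta> + cnj \<beta> * x$2"
  shows "c *s vector [2 - cnj \<beta> * x$1, x$1 - 2 * cnj \<beta> * x$2] \<in> tangent_space (Orb x) x"
proof -
  let ?s = "x$1" and ?p = "x$2"
  have p1: "norm ?p < 1" by (rule norm_components_sym_bidisc [OF x])
  define \<alpha> where "\<alpha> = (c - ?p * cnj c) / of_real (1 - (norm ?p)\<^sup>2)"
  have \<alpha>: "\<alpha> + cnj \<alpha> * ?p = c"
    unfolding \<alpha>_def by (rule conjugate_linear_solution [OF p1])
  define \<theta> where "\<theta> = 2 * Im (cnj \<alpha> * \<beta>)"
  have th: "\<i> * of_real \<theta> = cnj \<alpha> * \<beta> - \<alpha> * cnj \<beta>"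
    by (simp add: \<theta>_def complex_eq_iff)
  have key: "\<i> * of_real \<theta> - cnj \<alpha> * ?s = - cnj \<beta> * c"
    unfolding th \<beta> by (simp add: algebra_simps flip: \<alpha>)
  have "\<i> * of_real \<theta> * ?s + 2 * \<alpha> + 2 * cnj \<alpha> * ?p - cnj \<alpha> * ?s\<^sup>2
      = (\<i> * of_real \<theta> - cnj \<alpha> * ?s) * ?s + 2 * (\<alpha> + cnj \<alpha> * ?p)"
    by (simp add: power2_eq_square algebra_simps)
  moreover have "2 * \<i> * of_real \<theta> * ?p + \<alpha> * ?s - cnj \<alpha> * ?s * ?p
      = 2 * (\<i> * of_real \<theta> - cnj \<alpha> * ?s) * ?p + (\<alpha> + cnj \<alpha> * ?p) * ?s"
    by (simp add: algebra_simps)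
  ultimately have "vector [\<i> * of_real \<theta> * ?s + 2 * \<alpha> + 2 * cnj \<alpha> * ?p - cnj \<alpha> * ?s\<^sup>2,
          2 * \<i> * of_real \<theta> * ?p + \<alpha> * ?s - cnj \<alpha> * ?s * ?p]
       = c *s (vector [2 - cnj \<beta> * ?s, ?s - 2 * cnj \<beta> * ?p] :: complex^2)"
    unfolding key \<alpha> by (simp add: vec2_eq_iff algebra_simps)
  thus ?thesis using Moebius_orbit_velocity[OF x, of \<theta> \<alpha>] by metis
qed

text \<open>
  The line on the right is tangent to the orbit by the choice of Moebius velocities, and
  no other complex line is, because the tangent vectors lie in a real hyperplane.
\<close>

lemma sharp_direction_eq:
  assumes x: "x \<in> sym_bidisc" and \<beta>: "norm \<beta> < 1" "x$1 = \<beta> + cnj \<beta> * x$2"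
  shows "sharp_direction x = vec.span {vector [2 - cnj \<beta> * x$1, x$1 - 2 * cnj \<beta> * x$2]}"
    (is "_ = vec.span {?v}")
proof -
  have "norm (cnj \<beta> * x$1) < 2"
    using norm_components_sym_bidisc(1)[OF x] \<beta>(1) mult_strict_mono'[of "norm \<beta>" 1 "norm (x$1)" 2]
    by (simp add: norm_mult)
  hence "2 - cnj \<beta> * x$1 \<noteq> 0" by auto
  hence v0: "?v \<noteq> 0" by (auto simp: vec2_eq_iff)
  obtain l m where lm: "l \<noteq> 0 \<or> m \<noteq> 0" 
    and T: "\<And>v. v \<in> tangent_space (Orb x) x \<Longrightarrow> Re (l * v$1 + m * v$2) = 0"
    using tangent_space_Orb_hyperplane [OF x] by blast
  have V: "vec.subspace (vec.span {?v})" "vec.dim (vec.span {?v}) = 1"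
      "vec.span {?v} \<subseteq> tangent_space (Orb x) x"
  proof -
    have "vec.dim {?v} = 1" using v0 by (simp add: vec.dim_eq_card_independent)
    thus "vec.dim (vec.span {?v}) = 1" by simp
    show "vec.span {?v} \<subseteq> tangent_space (Orb x) x"
      using sharp_line_tangent[OF x \<beta>(2)] by (auto simp: vec.span_singleton)
  qed (rule vec.subspace_span)
  show ?thesis
    unfolding sharp_direction_def
  proof (rule the_equality)
    fix W assume "vec.subspace W \<and> vec.dim W = 1 \<and> W \<subseteq> tangent_space (Orb x) x"
    thus "W = vec.span {?v}"
      using complex_line_in_real_hyperplane_unique [OF lm T _ _ _ V] by blast
  qed (use V in blast)
qed

theorem corollary5p6:
  fixes x :: "complex^2"
  assumes "x \<in> sym_bidisc"
  shows "sharp_direction x \<noteq> flat_direction x"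
proof
  assume eq: "sharp_direction x = flat_direction x"
  obtain \<beta> where \<beta>: "norm \<beta> < 1" "x$1 = \<beta> + cnj \<beta> * x$2"
    using flat_parameter_exists[OF assms] by blast
  have "vector [cnj \<beta>, 1] \<in> vec.span {vector [2 - cnj \<beta> * x$1, x$1 - 2 * cnj \<beta> * x$2] :: complex^2}"
    using flat_direction_contains[OF assms \<beta>] sharp_direction_eq[OF assms \<beta>] eq by simp
  then obtain c where c: "cnj \<beta> = c * (2 - cnj \<beta> * x$1)" "1 = c * (x$1 - 2 * cnj \<beta> * x$2)"
    by (auto simp: vec.span_singleton vec2_eq_iff)
  obtain z w where zw: "norm z < 1" "norm w < 1" "x = sp z w" using assms mem_sym_bidisc by blast
  \<comment> \<open>up to sign the second factor is the determinant of the two spanning vectors; it factors over the roots of \<open>x\<close>\<close>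
  have "c * (2 * (1 - cnj \<beta> * x$1 + (cnj \<beta>)\<^sup>2 * x$2)) = c * (2 - cnj \<beta> * x$1) - cnj \<beta> * (c * (x$1 - 2 * cnj \<beta> * x$2))"
    by (simp add: power2_eq_square algebra_simps)
  also have "\<dots> = 0" by (simp flip: c)
  finally have "1 - cnj \<beta> * x$1 + (cnj \<beta>)\<^sup>2 * x$2 = 0"
    using c(2) unfolding mult_eq_0_iff by (metis mult_zero_left zero_neq_numeral zero_neq_one)
  hence "(1 - cnj \<beta> * z) * (1 - cnj \<beta> * w) = 0" by (simp add: zw denominator_factor)
  thus False using one_minus_mult_nonzero[of "cnj \<beta>"] zw \<beta>(1) by auto
qed

end
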